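(* Let $\mathcal{I}$ be a lattice in a totally real number field $F$ of degree $g$, let $\operatorname{Rec}\subset X_g=\mathrm{SL}_g(\mathbb{Z})\backslash\mathrm{SL}_g(\mathbb{R})/\mathrm{SO}_g(\mathbb{R})$ be the locus of lattices in $\mathbb{R}^g$ which have an orthogonal basis, and let $p_{\mathcal I}\colon T(\mathcal{I})\to X_g$ be the immersed compact flat associated to $\mathcal{I}$. Then there is a natural bijection between the set $p_{\mathcal I}^{-1}(\operatorname{Rec})$ and the set of rational and positive bases of $\mathcal{I}$ up to multiplication by units (elements of $U(\mathcal{I})$), changing signs, and reordering.
   Context: A lattice in $F$ is a subgroup of $(F,+)$ isomorphic to $\mathbb{Z}^g$. Fix an ordering of the $g$ real embeddings of $F$; these embed $F$, and hence $\mathcal{I}$, in $\mathbb{R}^g$. $X_g$ is the moduli space of lattices in $\mathbb{R}^g$, and $\mathcal{I}$ (rescaled to covolume one) is regarded as a point of the space of lattices $\mathrm{SL}_g(\mathbb{Z})\backslash\mathrm{SL}_g(\mathbb{R})$. $D\subset\mathrm{SL}_g(\mathbb{R})$ is the group of positive diagonal matrices, acting on $\mathrm{SL}_g(\mathbb{Z})\backslash\mathrm{SL}_g(\mathbb{R})$ on the right. $U(\mathcal{I})\subset F^*$ is the group of totally positive units $\epsilon$ with $\epsilon\mathcal{I}=\mathcal{I}$, embedded in $D$ via the $g$ real embeddings of $F$; it is the stabilizer of $\mathcal{I}$ under the action of $D$. $T(\mathcal{I})=U(\mathcal{I})\backslash D$ is a compact flat torus, and $p_{\mathcal I}\colon T(\mathcal{I})\to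 X_g$ is the isometric immersion induced by the orbit map $A\mapsto\mathcal{I}\cdot A$. Let $(r_1,\dots,r_g)$ be a $\mathbb{Z}$-basis of $\mathcal{I}$ and $(s_1,\dots,s_g)$ the dual basis of $F$ over $\mathbb{Q}$ with respect to the trace pairing, $\operatorname{Tr}^F_{\mathbb Q}(r_is_j)=\delta_{ij}$. The basis is called rational and positive if $\frac{r_i}{s_i}\big/\frac{r_j}{s_j}\in\mathbb{Q}^+$ (a positive rational number) for all $i\neq j$. *)

theory Defs
  imports "HOL-Analysis.Analysis" "HOL-Computational_Algebra.Polynomial"
begin

section \<open>Number fields\<close>

text \<open>
  A number field is a type of class \<^class>\<open>field_char_0\<close> that is
  finite-dimensional over its prime field.
\<close>

global_interpretation ratvs: vector_space "\<lambda>(q::rat) (x::'a::field_char_0). of_rat q * x"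
  by unfold_locales (auto simp: algebra_simps of_rat_add of_rat_mult)

text \<open>
  The dimension of an infinite-dimensional space is \<open>0\<close> in the library, so a positive value of
  \<open>field_degree\<close> entails finite-dimensionality.
\<close>

definition field_degree :: "'a::field_char_0 itself \<Rightarrow> nat" where
  "field_degree _ = ratvs.dim (UNIV :: 'a set)"

definition field_embedding :: "('a::field \<Rightarrow> 'b::field) \<Rightarrow> bool" where
  "field_embedding \<phi> \<longleftrightarrow>
     \<phi> 1 = 1 \<and> (\<forall>x y. \<phi> (x + y) = \<phi> x + \<phi> y) \<and> (\<forall>x y. \<phi> (x * y) = \<phi> x * \<phi> y)"

definition totally_real :: "'a::field_char_0 itself \<Rightarrow> bool" where
  "totally_real _ \<longleftrightarrow> (\<forall>\<phi> :: 'a \<Rightarrow> complex. field_embedding \<phi> \<longrightarrow> range \<phi> \<subseteq> \<real>)"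

text \<open>
  The trace of \<open>x\<close> is the trace of the rational linear map \<open>y \<mapsto> x * y\<close>;
  \<open>ratvs.extend_basis {}\<close> is some basis of the field over the rationals, on whose choice
  the result does not depend.
\<close>

definition field_trace :: "'a::field_char_0 \<Rightarrow> rat" where
  "field_trace x =
     (let B = ratvs.extend_basis ({} :: 'a set) in \<Sum>b\<in>B. ratvs.representation B (x * b) b)"

section \<open>Lattices and their bases\<close>

text \<open>The rank is the cardinality of the index type \<open>'n\<close>; \<open>int ^ 'n\<close> is the
  free abelian group of that rank.\<close>

definition lattice_in_field :: "'n::finite itself \<Rightarrow> 'a::ab_group_add set \<Rightarrow> bool" where
  "lattice_in_field _ L \<longleftrightarrow> (\<exists>h :: int ^ 'n \<Rightarrow> 'a. Modules.additive h \<and> inj h \<and> range h = L)"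

text \<open>The argument \<open>scl\<close> is the multiplication by integers of the ambient group. Bases
  are indexed families, hence ordered.\<close>

definition Z_basis :: "(int \<Rightarrow> 'v \<Rightarrow> 'v) \<Rightarrow> 'v::comm_monoid_add set \<Rightarrow> ('n::finite \<Rightarrow> 'v) \<Rightarrow> bool" where
  "Z_basis scl L b \<longleftrightarrow> bij_betw (\<lambda>m :: int ^ 'n. \<Sum>i\<in>UNIV. scl (m $ i) (b i)) UNIV L"

abbreviation field_Z_basis :: "'a::field_char_0 set \<Rightarrow> ('n::finite \<Rightarrow> 'a) \<Rightarrow> bool" where
  "field_Z_basis \<equiv> Z_basis (\<lambda>m x. of_int m * x)"

abbreviation vec_Z_basis :: "(real ^ 'n) set \<Rightarrow> ('n::finite \<Rightarrow> real ^ 'n) \<Rightarrow> bool" where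
  "vec_Z_basis \<equiv> Z_basis (\<lambda>m v. of_int m *\<^sub>R v)"

definition dual_basis :: "('n \<Rightarrow> 'a::field_char_0) \<Rightarrow> ('n \<Rightarrow> 'a) \<Rightarrow> bool" where
  "dual_basis r s \<longleftrightarrow> (\<forall>i j. field_trace (r i * s j) = (if i = j then 1 else 0))"

definition rational_positive :: "('n \<Rightarrow> 'a::field_char_0) \<Rightarrow> bool" where
  "rational_positive r \<longleftrightarrow>
     (\<exists>s. dual_basis r s \<and>
       (\<forall>i j. i \<noteq> j \<longrightarrow> (\<exists>q :: rat. q > 0 \<and> (r i / s i) / (r j / s j) = of_rat q)))"

section \<open>Spaces of lattices\<close>

text \<open>The matrix \<open>B\<close> represents the lattice spanned over the integers by its rows, so that
  the integral group acts on the left.\<close>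

definition SLR :: "(real ^ 'n ^ 'n::finite) set" where
  "SLR = {A. det A = 1}"

definition SLZ :: "(real ^ 'n ^ 'n::finite) set" where
  "SLZ = {A \<in> SLR. \<forall>i j. A $ i $ j \<in> \<int>}"

definition SOR :: "(real ^ 'n ^ 'n::finite) set" where
  "SOR = {A. rotation_matrix A}"

definition pos_diag :: "(real ^ 'n ^ 'n::finite) set" where
  "pos_diag = {A \<in> SLR. (\<forall>i. A $ i $ i > 0) \<and> (\<forall>i j. i \<noteq> j \<longrightarrow> A $ i $ j = 0)}"

definition double_coset :: "real ^ 'n ^ 'n \<Rightarrow> (real ^ 'n ^ 'n::finite) set" where
  "double_coset A = {C ** A ** K | C K. C \<in> SLZ \<and> K \<in> SOR}"

definition moduli_space :: "(real ^ 'n ^ 'n::finite) set set" where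
  "moduli_space = double_coset ` SLR"

definition row_lattice :: "real ^ 'n ^ 'n \<Rightarrow> (real ^ 'n::finite) set" where
  "row_lattice A = range (\<lambda>m :: int ^ 'n. \<Sum>i\<in>UNIV. of_int (m $ i) *\<^sub>R row i A)"

text \<open>All members \<open>B\<close> of a double coset have isometric row lattices, so the choice of
  \<open>B\<close> is immaterial.\<close>

definition Rec :: "(real ^ 'n ^ 'n::finite) set set" where
  "Rec = {X \<in> moduli_space. \<exists>B \<in> X. \<exists>b. vec_Z_basis (row_lattice B) b \<and>
                              pairwise (\<lambda>i j. orthogonal (b i) (b j)) UNIV}"

section \<open>The immersed flat associated to a lattice\<close>

text \<open>The argument \<open>\<sigma>\<close> lists the real embeddings of the field.\<close>

definition embed :: "('n \<Rightarrow> 'a \<Rightarrow> real) \<Rightarrow> 'a \<Rightarrow> real ^ 'n::finite" where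
  "embed \<sigma> x = (\<chi> k. \<sigma> k x)"

definition diag_embed :: "('n \<Rightarrow> 'a \<Rightarrow> real) \<Rightarrow> 'a \<Rightarrow> real ^ 'n ^ 'n::finite" where
  "diag_embed \<sigma> x = (\<chi> i j. if i = j then \<sigma> i x else 0)"

definition unit_group :: "('n \<Rightarrow> 'a \<Rightarrow> real) \<Rightarrow> 'a::field_char_0 set \<Rightarrow> 'a set" where
  "unit_group \<sigma> I = {\<epsilon>. \<epsilon> \<noteq> 0 \<and> algebraic_int \<epsilon> \<and> algebraic_int (inverse \<epsilon>) \<and>
                        (\<forall>k. \<sigma> k \<epsilon> > 0) \<and> (*) \<epsilon> ` I = I}"

definition torus_class ::
  "('n \<Rightarrow> 'a \<Rightarrow> real) \<Rightarrow> 'a::field_char_0 set \<Rightarrow> real ^ 'n ^ 'n \<Rightarrow> (real ^ 'n ^ 'n::finite) set" where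
  "torus_class \<sigma> I A = {diag_embed \<sigma> \<epsilon> ** A | \<epsilon>. \<epsilon> \<in> unit_group \<sigma> I}"

definition torus ::
  "('n \<Rightarrow> 'a \<Rightarrow> real) \<Rightarrow> 'a::field_char_0 set \<Rightarrow> (real ^ 'n ^ 'n::finite) set set" where
  "torus \<sigma> I = torus_class \<sigma> I ` pos_diag"

text \<open>The lattice \<open>I\<close>, rescaled to covolume one, as a point of the space of left cosets of
  \<open>SLZ\<close>: the coset of all matrices of determinant one whose rows span the rescaled lattice.\<close>

definition lattice_point ::
  "('n \<Rightarrow> 'a \<Rightarrow> real) \<Rightarrow> 'a set \<Rightarrow> (real ^ 'n ^ 'n::finite) set" where
  "lattice_point \<sigma> I =
     {B \<in> SLR. \<exists>c > 0. row_lattice B = (\<lambda>x. c *\<^sub>R embed \<sigma> x) ` I}"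

text \<open>The map induced by the orbit map \<open>A \<mapsto> I \<cdot> A\<close>, written as a product of sets of
  matrices: the coset \<open>lattice_point \<sigma> I\<close>, times the class \<open>t\<close> (different
  \<open>A \<in> t\<close> give the same contribution, as units preserve \<open>I\<close>), times \<open>SOR\<close>.\<close>

definition flat_map ::
  "('n \<Rightarrow> 'a \<Rightarrow> real) \<Rightarrow> 'a::field_char_0 set \<Rightarrow> (real ^ 'n ^ 'n) set \<Rightarrow> (real ^ 'n ^ 'n::finite) set" where
  "flat_map \<sigma> I t = {B ** A ** K | B A K. B \<in> lattice_point \<sigma> I \<and> A \<in> t \<and> K \<in> SOR}"

section \<open>Classes of rational and positive bases\<close>

definition rp_bases :: "'a::field_char_0 set \<Rightarrow> ('n::finite \<Rightarrow> 'a) set" where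
  "rp_bases I = {r. field_Z_basis I r \<and> rational_positive r}"

text \<open>Bases are related if they differ by a unit in \<open>U(I)\<close>, signs and reordering.\<close>

definition basis_rel ::
  "('n \<Rightarrow> 'a \<Rightarrow> real) \<Rightarrow> 'a::field_char_0 set \<Rightarrow> (('n::finite \<Rightarrow> 'a) \<times> ('n \<Rightarrow> 'a)) set" where
  "basis_rel \<sigma> I = {(r, r'). r \<in> rp_bases I \<and> r' \<in> rp_bases I \<and>
     (\<exists>\<epsilon> \<in> unit_group \<sigma> I. \<exists>\<eta> :: 'n \<Rightarrow> 'a. \<exists>\<pi> :: 'n \<Rightarrow> 'n.
        range \<eta> \<subseteq> {1, -1} \<and> bij \<pi> \<and> (\<forall>i. r' i = \<epsilon> * \<eta> i * r (\<pi> i)))}"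

end

theory Submission
  imports Defs
begin

text \<open>
  By the trace form \<open>Tr (x * y) = (\<Sum>k. \<sigma>\<^sub>k x * \<sigma>\<^sub>k y)\<close>, a basis \<open>r\<close> of the lattice becomes
  orthogonal after scaling the coordinates by \<open>a\<^sub>k\<close> iff \<open>a\<^sub>k\<^sup>2 * \<sigma>\<^sub>k (r j)\<close> is a positive multiple
  \<open>l j\<close> of \<open>\<sigma>\<^sub>k (s j)\<close> for the dual basis \<open>s\<close>, that is, \<open>\<sigma>\<^sub>k (r j / s j) = l j / a\<^sub>k\<^sup>2\<close>. Quotients of
  these elements have the same image under all embeddings, so they are positive rational numbers;
  conversely a rational and positive basis determines the \<open>a\<^sub>k\<close> up to a common factor. Since an
  orthogonal basis of a lattice is unique up to signs and order, points of the torus over \<open>Rec\<close>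
  correspond to classes of such bases.
\<close>

section \<open>Real embeddings, trace and dual bases\<close>

text \<open>Sending a point of the torus to the set \<open>orth_bases I t\<close> of all bases made
  orthogonal by some member of the class \<open>t\<close> avoids choosing a matrix or a basis; the
  work lies in showing that this set is exactly one class of \<open>basis_rel\<close>. The common
  factor that a basis leaves open is fixed by determinant one. Two facts about units are drawn from
  the lattice itself: an element that maps \<open>I\<close> onto itself is an algebraic integer
  together with its inverse, and if it is totally positive, its diagonal matrix has determinant one,
  since covolume is preserved. Without the second fact units would not act on
  \<open>pos_diag\<close>. Bases of \<open>I\<close> come in both orientations, while
  \<open>SLZ\<close> contains only determinant one. This does no harm, because \<open>Rec\<close>
  and \<open>lattice_point\<close> refer to the row lattice, which does not record an
  orientation.\<close>

locale real_embeddings =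
  fixes \<sigma> :: "'n::finite \<Rightarrow> 'a::field_char_0 \<Rightarrow> real"
  assumes degree: "field_degree TYPE('a) = CARD('n)"
    and field_embedding: "field_embedding (\<sigma> k)"
    and inj_sigma: "inj \<sigma>"
begin

lemma sigma_1 [simp]: "\<sigma> k 1 = 1"
  and sigma_add [simp]: "\<sigma> k (x + y) = \<sigma> k x + \<sigma> k y"
  and sigma_mult [simp]: "\<sigma> k (x * y) = \<sigma> k x * \<sigma> k y"
  using field_embedding[of k] by (auto simp: field_embedding_def)

lemma sigma_0 [simp]: "\<sigma> k 0 = 0"
  using sigma_add[of k 0 0] by simp

lemma sigma_uminus [simp]: "\<sigma> k (- x) = - \<sigma> k x"
  using sigma_add[of k x "- x"] by simp

lemma sigma_diff [simp]: "\<sigma> k (x - y) = \<sigma> k x - \<sigma> k y"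
  using sigma_add[of k x "- y"] by simp

lemma sigma_sum [simp]: "\<sigma> k (\<Sum>i\<in>S. f i) = (\<Sum>i\<in>S. \<sigma> k (f i))"
  by (induction S rule: infinite_finite_induct) auto

lemma sigma_eq_0_iff [simp]: "\<sigma> k x = 0 \<longleftrightarrow> x = 0"
proof
  assume "\<sigma> k x = 0"
  then have "\<sigma> k (x * inverse x) = 0" by (simp del: right_inverse)
  then show "x = 0" by (metis right_inverse sigma_1 zero_neq_one)
qed simp

lemma sigma_eq_iff [simp]: "\<sigma> k x = \<sigma> k y \<longleftrightarrow> x = y"
  using sigma_eq_0_iff[of k "x - y"] by (simp del: sigma_eq_0_iff)

lemma sigma_inverse [simp]: "\<sigma> k (inverse x) = inverse (\<sigma> k x)"
proof (cases "x = 0")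
  case False
  then have "\<sigma> k x * \<sigma> k (inverse x) = 1"
    by (metis right_inverse sigma_1 sigma_mult)
  then show ?thesis by (metis inverse_unique)
qed simp

lemma sigma_divide [simp]: "\<sigma> k (x / y) = \<sigma> k x / \<sigma> k y"
  by (simp add: divide_inverse)

lemma sigma_of_nat [simp]: "\<sigma> k (of_nat m) = of_nat m"
  by (induction m) auto

lemma sigma_of_int [simp]: "\<sigma> k (of_int m) = of_int m"
  by (cases m) auto

lemma sigma_of_rat [simp]: "\<sigma> k (of_rat q) = of_rat q"
  by (cases q) (simp add: of_rat_rat)

text \<open>Dedekind's independence of characters. For \<open>j\<close> in \<open>K\<close> choose
  \<open>y\<close> with different images under \<open>\<sigma> l\<close> and
  \<open>\<sigma> j\<close>; subtracting \<open>\<sigma> l y\<close> times the relation at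
  \<open>x\<close> from the relation at \<open>x * y\<close> eliminates the index \<open>l\<close>,
  and the induction hypothesis applies.\<close>

lemma embeddings_independent:
  assumes "finite K" "\<And>x. (\<Sum>k\<in>K. c k * \<sigma> k x) = 0" "k \<in> K"
  shows "c k = 0"
  using assms
proof (induction K arbitrary: c k rule: finite_induct)
  case empty
  then show ?case by simp
next
  case (insert l K)
  have eq: "(\<Sum>k\<in>K. c k * \<sigma> k x) = - (c l * \<sigma> l x)" for x
    using insert.prems(1)[of x] insert.hyps by (simp add: eq_neg_iff_add_eq_0 add.commute)
  have K: "c j = 0" if j: "j \<in> K" for j
  proof -
    from j insert.hyps inj_sigma have "\<sigma> l \<noteq> \<sigma> j" by (auto simp: inj_eq)
    then obtain y where y: "\<sigma> l y \<noteq> \<sigma> j y" by auto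
    have "c j * (\<sigma> j y - \<sigma> l y) = 0"
    proof (rule insert.IH[of "\<lambda>k. c k * (\<sigma> k y - \<sigma> l y)"])
      fix x
      have "(\<Sum>k\<in>K. c k * (\<sigma> k y - \<sigma> l y) * \<sigma> k x) =
          (\<Sum>k\<in>K. c k * \<sigma> k (x * y)) - \<sigma> l y * (\<Sum>k\<in>K. c k * \<sigma> k x)"
        by (simp add: sum_distrib_left sum_subtractf algebra_simps)
      also have "\<dots> = 0"
        by (simp only: eq) simp
      finally show "(\<Sum>k\<in>K. c k * (\<sigma> k y - \<sigma> l y) * \<sigma> k x) = 0" .
    qed (use j in auto)
    with y show ?thesis by simp
  qed
  with eq[of 1] have "c l = 0" by simp
  with K insert.prems show ?case by auto
qed

text \<open>Only spanning is recorded: a spanning family indexed by \<open>'n\<close> has as many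
  members as the degree, so its independence is automatic.\<close>

definition rat_basis :: "('n \<Rightarrow> 'a) \<Rightarrow> bool" where
  "rat_basis r \<longleftrightarrow> (\<forall>x. \<exists>q :: 'n \<Rightarrow> rat. x = (\<Sum>i\<in>UNIV. of_rat (q i) * r i))"

definition emb_matrix :: "('n \<Rightarrow> 'a) \<Rightarrow> real ^ 'n ^ 'n" where
  "emb_matrix r = (\<chi> i. embed \<sigma> (r i))"

lemma emb_matrix_nth [simp]: "emb_matrix r $ i $ k = \<sigma> k (r i)"
  by (simp add: emb_matrix_def embed_def)

text \<open>The combination of embeddings with coefficients \<open>c\<close> vanishes on
  \<open>r\<close>, hence on all rational combinations of \<open>r\<close>, which is the whole
  field; independence of the embeddings finishes.\<close>

lemma emb_matrix_ker:
  assumes "rat_basis r" "\<And>i. (\<Sum>k\<in>UNIV. \<sigma> k (r i) * c k) = 0"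
  shows "c k = 0"
proof (rule embeddings_independent[of UNIV])
  fix x
  from assms(1) obtain q where q: "x = (\<Sum>i\<in>UNIV. of_rat (q i) * r i)"
    by (auto simp: rat_basis_def)
  have "(\<Sum>k\<in>UNIV. c k * \<sigma> k x) = (\<Sum>k\<in>UNIV. \<Sum>i\<in>UNIV. of_rat (q i) * (\<sigma> k (r i) * c k))"
    by (simp add: q sum_distrib_left algebra_simps)
  also have "\<dots> = (\<Sum>i\<in>UNIV. of_rat (q i) * (\<Sum>k\<in>UNIV. \<sigma> k (r i) * c k))"
    by (subst sum.swap) (simp add: sum_distrib_left)
  finally show "(\<Sum>k\<in>UNIV. c k * \<sigma> k x) = 0"
    by (simp add: assms(2))
qed auto

lemma emb_matrix_invertible:
  assumes "rat_basis r"
  shows "invertible (emb_matrix r)"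
  unfolding invertible_left_inverse matrix_left_invertible_ker
proof (intro allI impI)
  fix c :: "real ^ 'n"
  assume "emb_matrix r *v c = 0"
  then have "(\<Sum>k\<in>UNIV. \<sigma> k (r i) * c $ k) = 0" for i
    by (simp add: vec_eq_iff matrix_vector_mult_def)
  then show "c = 0"
    using emb_matrix_ker[OF assms, of "\<lambda>k. c $ k"] by (simp add: vec_eq_iff)
qed

lemma card_rat_basis:
  assumes "ratvs.independent B" "ratvs.span B = (UNIV :: 'a set)"
  shows "finite B" "card B = CARD('n)"
proof -
  have "ratvs.dim (UNIV :: 'a set) = card B"
    by (rule ratvs.dim_eq_card) (use assms in auto)
  with degree show "card B = CARD('n)" by (simp add: field_degree_def)
  \<comment> \<open>An infinite set would have cardinality 0.\<close>
  then show "finite B" by (intro card_ge_0_finite) simp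
qed

text \<open>A basis of the field containing \<open>range r\<close> has \<open>CARD('n)\<close>
  elements, and \<open>range r\<close> already has that many: a repetition in \<open>r\<close> would
  be a relation with coefficients 1 and -1.\<close>

lemma independent_imp_rat_basis:
  assumes "\<And>q :: 'n \<Rightarrow> rat. (\<Sum>i\<in>UNIV. of_rat (q i) * r i) = (0::'a) \<Longrightarrow> (\<forall>i. q i = 0)"
  shows "rat_basis r"
proof -
  have inj: "inj r"
  proof (rule injI, rule ccontr)
    fix i j assume ij: "r i = r j" "i \<noteq> j"
    define q :: "'n \<Rightarrow> rat" where "q k = (if k = i then 1 else if k = j then - 1 else 0)" for k
    have "(\<Sum>k\<in>UNIV. of_rat (q k) * r k) = (\<Sum>k\<in>{i,j}. of_rat (q k) * r k)"
      by (rule sum.mono_neutral_right) (auto simp: q_def)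
    also have "\<dots> = 0" using ij by (simp add: q_def of_rat_minus)
    finally have "q i = 0" using assms by blast
    then show False by (simp add: q_def)
  qed
  have ind: "ratvs.independent (range r)"
  proof (rule ratvs.independent_if_scalars_zero)
    fix f :: "'a \<Rightarrow> rat" and x
    assume f: "(\<Sum>x\<in>range r. of_rat (f x) * x) = 0" and x: "x \<in> range r"
    from f have "(\<Sum>i\<in>UNIV. of_rat (f (r i)) * r i) = 0"
      by (simp add: sum.reindex[OF inj])
    from assms[OF this] x show "f x = 0" by auto
  qed simp
  define B where "B = ratvs.extend_basis (range r)"
  have B: "range r \<subseteq> B" "ratvs.independent B" "ratvs.span B = UNIV"
    unfolding B_def using ind
    by (simp_all add: ratvs.extend_basis_superset ratvs.independent_extend_basis)
  have "range r = B"
    using card_rat_basis[OF B(2,3)] B(1) inj by (intro card_subset_eq) (auto simp: card_image)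
  with B(3) have "ratvs.span (range r) = UNIV" by simp
  then have sp: "range (\<lambda>u. \<Sum>v\<in>range r. of_rat (u v) * v) = (UNIV :: 'a set)"
    by (subst (asm) ratvs.span_finite) auto
  show ?thesis unfolding rat_basis_def
  proof
    fix x
    have "x \<in> range (\<lambda>u. \<Sum>v\<in>range r. of_rat (u v) * v)" by (simp add: sp)
    then obtain u where "x = (\<Sum>v\<in>range r. of_rat (u v) * v)" by auto
    then have "x = (\<Sum>i\<in>UNIV. of_rat (u (r i)) * r i)"
      by (simp add: sum.reindex[OF inj])
    then show "\<exists>q :: 'n \<Rightarrow> rat. x = (\<Sum>i\<in>UNIV. of_rat (q i) * r i)"
      by (intro exI[of _ "\<lambda>i. u (r i)"])
  qed
qed

lemma diag_embed_nth [simp]: "diag_embed \<sigma> x $ i $ j = (if i = j then \<sigma> i x else 0)"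
  by (simp add: diag_embed_def)

text \<open>The embeddings diagonalise multiplication by \<open>x\<close> simultaneously:
  conjugation by \<open>emb_matrix e\<close> carries its matrix \<open>M\<close> in the basis
  \<open>e\<close> to the diagonal matrix with entries \<open>\<sigma> k x\<close>, and conjugate
  matrices have equal traces.\<close>

lemma of_rat_field_trace: "real_of_rat (field_trace x) = (\<Sum>k\<in>UNIV. \<sigma> k x)"
proof -
  define B where "B = ratvs.extend_basis ({} :: 'a set)"
  have B: "ratvs.independent B" "ratvs.span B = UNIV"
    unfolding B_def by (simp_all add: ratvs.independent_extend_basis ratvs.independent_empty)
  note fin = card_rat_basis[OF B]
  then obtain e :: "'n \<Rightarrow> 'a" where e: "bij_betw e UNIV B"
    using finite_same_card_bij[of "UNIV :: 'n set" B] by auto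
  have rep: "(\<Sum>i\<in>UNIV. of_rat (ratvs.representation B y (e i)) * e i) = y" for y
  proof -
    have "(\<Sum>b\<in>B. of_rat (ratvs.representation B y b) * b) = y"
      using ratvs.sum_representation_eq[OF B(1) _ fin(1), of y] B(2) by auto
    then show ?thesis
      by (subst sum.reindex_bij_betw[OF e, of "\<lambda>b. of_rat (ratvs.representation B y b) * b"])
  qed
  have "rat_basis e"
    unfolding rat_basis_def
  proof
    fix y show "\<exists>q :: 'n \<Rightarrow> rat. y = (\<Sum>i\<in>UNIV. of_rat (q i) * e i)"
      by (intro exI[of _ "\<lambda>i. ratvs.representation B y (e i)"]) (simp add: rep)
  qed
  then have "invertible (emb_matrix e)" by (rule emb_matrix_invertible)
  then obtain S where S: "emb_matrix e ** S = mat 1" "S ** emb_matrix e = mat 1"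
    by (auto simp: invertible_def)
  define M :: "real ^ 'n ^ 'n" where
    "M = (\<chi> i j. of_rat (ratvs.representation B (x * e i) (e j)))"
  have "M ** emb_matrix e = emb_matrix e ** diag_embed \<sigma> x"
  proof -
    have "(\<Sum>j\<in>UNIV. M $ i $ j * \<sigma> k (e j)) = \<sigma> k (e i) * \<sigma> k x" for i k
      using arg_cong[OF rep[of "x * e i"], of "\<sigma> k"] by (simp add: M_def mult.commute)
    then show ?thesis
      by (simp add: vec_eq_iff matrix_matrix_mult_def if_distrib[of "\<lambda>x. _ * x"] cong: if_cong)
  qed
  then have "M = emb_matrix e ** (diag_embed \<sigma> x ** S)"
    by (metis S(1) matrix_mul_assoc matrix_mul_rid)
  then have "trace M = trace (diag_embed \<sigma> x ** S ** emb_matrix e)"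
    by (simp add: trace_mul_sym[of "emb_matrix e"])
  also have "\<dots> = trace (diag_embed \<sigma> x)"
    by (simp add: S(2) flip: matrix_mul_assoc)
  finally have "trace M = (\<Sum>k\<in>UNIV. \<sigma> k x)" by (simp add: trace_def)
  moreover have "real_of_rat (field_trace x) = trace M"
    unfolding field_trace_def Let_def B_def[symmetric]
    by (subst sum.reindex_bij_betw[OF e, symmetric]) (simp add: trace_def M_def of_rat_sum)
  ultimately show ?thesis by simp
qed

lemma dual_basis_iff:
  "dual_basis r s \<longleftrightarrow> (\<forall>i j. (\<Sum>k\<in>UNIV. \<sigma> k (r i) * \<sigma> k (s j)) = (if i = j then 1 else 0))"
proof -
  have "field_trace (r i * s j) = (if i = j then 1 else 0) \<longleftrightarrow>
      real_of_rat (field_trace (r i * s j)) = (if i = j then 1 else 0)" for i j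
    by simp
  then show ?thesis unfolding dual_basis_def of_rat_field_trace by simp
qed

text \<open>The Gram matrix of the trace form is nonsingular, since over the reals it factors as
  \<open>emb_matrix r\<close> times its transpose. It is inverted over the rationals, so that the
  columns of the inverse are coefficients of elements of the field.\<close>

lemma dual_basis_exists:
  assumes "rat_basis r"
  obtains s where "dual_basis r s"
proof -
  define G :: "rat ^ 'n ^ 'n" where "G = (\<chi> i j. field_trace (r i * r j))"
  have "real_of_rat (det G) = det (\<chi> i j. real_of_rat (G $ i $ j))"
    by (simp add: det_def of_rat_sum of_rat_mult of_rat_prod)
  also have "(\<chi> i j. real_of_rat (G $ i $ j)) = emb_matrix r ** transpose (emb_matrix r)"
    by (simp add: vec_eq_iff G_def of_rat_field_trace matrix_matrix_mult_def transpose_def)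
  also have "det \<dots> \<noteq> 0"
    using emb_matrix_invertible[OF assms] by (simp add: det_mul invertible_det_nz)
  finally have "invertible G" by (simp add: invertible_det_nz)
  then obtain H where H: "G ** H = mat 1" by (auto simp: invertible_def)
  define s where "s j = (\<Sum>l\<in>UNIV. of_rat (H $ l $ j) * r l)" for j
  have "(\<Sum>k\<in>UNIV. \<sigma> k (r i) * \<sigma> k (s j)) = (if i = j then 1 else 0)" for i j
  proof -
    have "(\<Sum>k\<in>UNIV. \<sigma> k (r i) * \<sigma> k (s j)) =
        (\<Sum>k\<in>UNIV. \<Sum>l\<in>UNIV. of_rat (H $ l $ j) * \<sigma> k (r i * r l))"
      by (simp add: s_def sum_distrib_left algebra_simps)
    also have "\<dots> = (\<Sum>l\<in>UNIV. of_rat (G $ i $ l) * of_rat (H $ l $ j))"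
      by (subst sum.swap) (simp add: G_def of_rat_field_trace sum_distrib_left mult.commute)
    also have "\<dots> = of_rat ((G ** H) $ i $ j)"
      by (simp add: matrix_matrix_mult_def of_rat_sum of_rat_mult)
    finally show ?thesis by (simp add: H mat_def)
  qed
  then show ?thesis by (intro that[of s]) (simp add: dual_basis_iff)
qed

text \<open>The trace of \<open>x\<close> is \<open>CARD('n)\<close> times \<open>\<mu>\<close>, so
  \<open>\<mu>\<close> is rational; injectivity of an embedding then identifies
  \<open>x\<close>.\<close>

lemma eq_of_rat_if_sigma_const:
  assumes "\<And>k. \<sigma> k x = \<mu>"
  obtains q where "x = of_rat q" "\<mu> = of_rat q"
proof -
  have "real_of_rat (field_trace x) = of_nat CARD('n) * \<mu>"
    by (simp add: of_rat_field_trace assms)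
  then have "\<mu> = of_rat (field_trace x / of_nat CARD('n))"
    by (simp add: of_rat_divide field_simps)
  moreover from this have "x = of_rat (field_trace x / of_nat CARD('n))"
    by (metis assms sigma_eq_iff sigma_of_rat)
  ultimately show thesis using that by blast
qed

end

section \<open>Integral matrices and lattice bases\<close>

definition of_int_vec :: "int ^ 'n \<Rightarrow> real ^ 'n::finite" where
  "of_int_vec m = (\<chi> i. of_int (m $ i))"

definition of_int_mat :: "int ^ 'n ^ 'm \<Rightarrow> real ^ 'n::finite ^ 'm::finite" where
  "of_int_mat C = (\<chi> i. of_int_vec (C $ i))"

lemma of_int_vec_nth [simp]: "of_int_vec m $ i = of_int (m $ i)"
  by (simp add: of_int_vec_def)

lemma of_int_mat_nth [simp]: "of_int_mat C $ i $ j = of_int (C $ i $ j)"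
  by (simp add: of_int_mat_def)

lemma of_int_mat_mult: "of_int_mat (C ** D) = of_int_mat C ** of_int_mat D"
  by (simp add: vec_eq_iff matrix_matrix_mult_def)

lemma of_int_vec_mult: "of_int_vec m v* of_int_mat C = of_int_vec (m v* C)"
  by (simp add: vec_eq_iff vector_matrix_mult_def)

lemma of_int_mat_1 [simp]: "of_int_mat (mat 1) = mat 1"
  by (simp add: vec_eq_iff mat_def)

lemma of_int_mat_eq_iff: "of_int_mat C = of_int_mat D \<longleftrightarrow> C = D"
  by (simp add: vec_eq_iff)

lemma det_of_int_mat: "det (of_int_mat C) = of_int (det C)"
  by (simp add: det_def)

lemma det_scaleR: "det (c *\<^sub>R A :: real ^ 'n ^ 'n) = c ^ CARD('n) * det A"
proof -
  have "c *\<^sub>R A = (\<chi> i. c *s (A $ i))"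
    by (simp add: vec_eq_iff)
  then show ?thesis using det_rows_mul[of "\<lambda>_. c" "\<lambda>i. A $ i"] by simp
qed

lemma mem_SLZ_iff: "A \<in> SLZ \<longleftrightarrow> (\<exists>C. A = of_int_mat C \<and> det C = 1)"
proof
  assume A: "A \<in> SLZ"
  define C where "C = (\<chi> i j. \<lfloor>A $ i $ j\<rfloor>)"
  have "A = of_int_mat C"
    using A by (auto simp: SLZ_def C_def vec_eq_iff of_int_floor_cancel)
  moreover from this A have "real_of_int (det C) = 1"
    by (simp add: SLZ_def SLR_def flip: det_of_int_mat)
  ultimately show "\<exists>C. A = of_int_mat C \<and> det C = 1" by auto
qed (auto simp: SLZ_def SLR_def det_of_int_mat)

text \<open>\<open>D\<close> is the adjugate matrix, written as in Cramer's rule: its entries are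
  determinants of integral matrices, hence integers, and the denominator \<open>det C\<close> is 1.
  The product is computed over the reals and read back over the integers.\<close>

lemma int_mat_inverse:
  fixes C :: "int ^ 'n ^ 'n"
  assumes "det C = 1"
  obtains D where "C ** D = mat 1" "D ** C = mat 1"
proof -
  define D :: "int ^ 'n ^ 'n" where
    "D = (\<chi> k j. det (\<chi> i l. if l = k then axis j 1 $ i else C $ i $ l))"
  have col: "of_int_mat C *v column j (of_int_mat D) = axis j 1" for j
  proof -
    have "column j (of_int_mat D) = (\<chi> k. det (\<chi> i l. if l = k then axis j 1 $ i
        else of_int_mat C $ i $ l) / det (of_int_mat C))"
    proof -
      have eq: "of_int_mat (\<chi> i l. if l = k then axis j 1 $ i else C $ i $ l) =
          (\<chi> i l. if l = k then axis j 1 $ i else of_int_mat C $ i $ l)" for k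
        by (simp add: vec_eq_iff axis_def)
      show ?thesis
        unfolding eq[symmetric] det_of_int_mat assms by (simp add: vec_eq_iff column_def D_def)
    qed
    then show ?thesis
      by (subst cramer) (simp_all add: det_of_int_mat assms)
  qed
  have "of_int_mat (C ** D) = of_int_mat (mat 1)"
  proof -
    have "(of_int_mat C ** of_int_mat D) $ i $ j = (mat 1 :: real ^ 'n ^ 'n) $ i $ j" for i j
      using arg_cong[OF col[of j], of "\<lambda>v. v $ i"]
      by (simp add: matrix_matrix_mult_def matrix_vector_mult_def column_def mat_def axis_def)
    then show ?thesis by (simp add: of_int_mat_mult vec_eq_iff)
  qed
  moreover from this have "of_int_mat (D ** C) = of_int_mat (mat 1)"
    by (simp add: of_int_mat_mult matrix_left_right_inverse)
  ultimately show thesis by (intro that[of D]) (simp_all only: of_int_mat_eq_iff)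
qed

section \<open>Lattices spanned by the rows of a matrix\<close>

lemma row_lattice_alt: "row_lattice B = range (\<lambda>m. of_int_vec m v* B)"
  by (simp add: row_lattice_def vector_matrix_mult_def vec_eq_iff row_def image_def)

lemma row_lattice_mult: "row_lattice (B ** A) = (\<lambda>v. v v* A) ` row_lattice B"
  by (simp add: row_lattice_alt image_image vector_matrix_mul_assoc)

lemma row_lattice_scaleR: "row_lattice (c *\<^sub>R B) = (\<lambda>v. c *\<^sub>R v) ` row_lattice B"
  by (simp add: row_lattice_alt image_image vector_scaleR_matrix_ac)

lemma row_lattice_int_mult_subset: "row_lattice (of_int_mat C ** B) \<subseteq> row_lattice B"
  by (auto simp: row_lattice_alt of_int_vec_mult simp flip: vector_matrix_mul_assoc)

lemma row_lattice_int_mult: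
  assumes "D ** C = mat 1"
  shows "row_lattice (of_int_mat C ** B) = row_lattice B"
proof
  have "B = of_int_mat D ** (of_int_mat C ** B)"
    by (simp add: matrix_mul_assoc assms flip: of_int_mat_mult)
  then show "row_lattice B \<subseteq> row_lattice (of_int_mat C ** B)"
    by (metis row_lattice_int_mult_subset)
qed (rule row_lattice_int_mult_subset)

lemma row_lattice_SLZ_mult: "C \<in> SLZ \<Longrightarrow> row_lattice (C ** B) = row_lattice B"
  by (metis mem_SLZ_iff int_mat_inverse row_lattice_int_mult)

text \<open>Each row of \<open>B'\<close> lies in its own lattice, hence is an integral combination
  of the rows of \<open>B\<close>. Applied in both directions, this turns an equality of lattices
  into integral factors, whose determinants can be compared.\<close>

lemma row_lattice_subsetD:
  assumes "row_lattice B' \<subseteq> row_lattice B"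
  obtains C where "B' = of_int_mat C ** B"
proof -
  have "\<exists>m. row i B' = of_int_vec m v* B" for i
  proof -
    have "of_int_vec (axis i 1) v* B' = row i B'"
      by (simp add: vec_eq_iff vector_matrix_mult_def row_def axis_def if_distrib[of "\<lambda>x. x * _"]
          if_distrib[of of_int] cong: if_cong)
    then have "row i B' \<in> row_lattice B'" by (metis rangeI row_lattice_alt)
    with assms show ?thesis by (auto simp: row_lattice_alt)
  qed
  then obtain C where C: "\<And>i. row i B' = of_int_vec (C i) v* B" by metis
  have "B' = of_int_mat (\<chi> i. C i) ** B"
    using C by (simp add: vec_eq_iff row_def vector_matrix_mult_def matrix_matrix_mult_def)
  then show thesis by (rule that)
qed

section \<open>Integral bases of a lattice in the field\<close>

lemma field_Z_basis_exists:
  assumes "lattice_in_field TYPE('n::finite) (I :: 'a::field_char_0 set)"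
  obtains r :: "'n::finite \<Rightarrow> 'a::field_char_0" where "field_Z_basis I r"
proof -
  obtain h :: "int ^ 'n \<Rightarrow> 'a" where h: "Modules.additive h" "inj h" "range h = I"
    using assms by (auto simp: lattice_in_field_def)
  interpret h: Modules.additive h by (rule h(1))
  \<comment> \<open>An additive map commutes with integer multiples; the induction runs upwards and
    downwards from 0.\<close>
  have axis: "h (axis i c) = of_int c * h (axis i 1)" for i c
  proof (induction c rule: int_induct[of _ 0])
    case base
    have "axis i 0 = (0 :: int ^ 'n)" by (simp add: axis_def vec_eq_iff)
    then show ?case by (metis h.zero mult_zero_left of_int_0)
  next
    case (step1 c)
    have "axis i (c + 1) = (axis i c + axis i 1 :: int ^ 'n)"
      by (simp add: axis_def vec_eq_iff)
    with step1 show ?case by (simp add: h.add algebra_simps)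
  next
    case (step2 c)
    have "axis i (c - 1) = (axis i c - axis i 1 :: int ^ 'n)"
      by (simp add: axis_def vec_eq_iff)
    then have "h (axis i (c - 1)) = h (axis i c) - h (axis i 1)" by (simp only: h.diff)
    with step2 show ?case by (simp add: algebra_simps)
  qed
  have "h m = (\<Sum>i\<in>UNIV. of_int (m $ i) * h (axis i 1))" for m
  proof -
    have "m = (\<Sum>i\<in>UNIV. axis i (m $ i))"
      by (simp add: vec_eq_iff axis_def)
    from arg_cong[OF this, of h] have "h m = (\<Sum>i\<in>UNIV. h (axis i (m $ i)))"
      by (simp only: h.sum)
    then show ?thesis by (subst (asm) axis)
  qed
  then have "(\<lambda>m. \<Sum>i\<in>UNIV. of_int (m $ i) * h (axis i 1)) = h"
    by (intro ext) (rule sym)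
  with h have "field_Z_basis I (\<lambda>i. h (axis i 1))"
    by (simp add: Z_basis_def bij_betw_def)
  then show thesis by (rule that)
qed

lemma Z_basis_elem:
  fixes b :: "'n::finite \<Rightarrow> 'v::comm_monoid_add"
  assumes "Z_basis scl L b" "\<And>x. scl 0 x = 0" "\<And>x. scl 1 x = x"
  shows "b i \<in> L"
proof -
  have "(\<Sum>j\<in>UNIV. scl ((axis i 1 :: int ^ 'n) $ j) (b j)) = (\<Sum>j\<in>UNIV. if j = i then b j else 0)"
    by (intro sum.cong) (auto simp: axis_def assms(2,3))
  also have "\<dots> = b i" by simp
  finally have "(\<Sum>j\<in>UNIV. scl ((axis i 1 :: int ^ 'n) $ j) (b j)) = b i" .
  moreover have "(\<Sum>j\<in>UNIV. scl ((axis i 1 :: int ^ 'n) $ j) (b j)) \<in> L"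
    using assms(1) by (auto simp: Z_basis_def bij_betw_def)
  ultimately show ?thesis by simp
qed

context
  fixes I :: "'a::field_char_0 set" and r :: "'n::finite \<Rightarrow> 'a"
  assumes r: "field_Z_basis I r"
begin

lemma field_Z_basis_coords:
  assumes "x \<in> I"
  obtains m :: "int ^ 'n" where "x = (\<Sum>i\<in>UNIV. of_int (m $ i) * r i)"
  using r assms by (auto simp: Z_basis_def bij_betw_def)

lemma field_Z_basis_unique:
  assumes "(\<Sum>i\<in>UNIV. of_int (m i) * r i) = (\<Sum>i\<in>UNIV. of_int (m' i) * r i)"
  shows "m i = m' i"
proof -
  have "inj (\<lambda>m :: int ^ 'n. \<Sum>i\<in>UNIV. of_int (m $ i) * r i)"
    using r by (simp add: Z_basis_def bij_betw_def)
  from injD[OF this, of "\<chi> i. m i" "\<chi> i. m' i"] assms show ?thesis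
    by (simp add: vec_eq_iff)
qed

lemma field_Z_basis_elem: "r i \<in> I"
  using r by (rule Z_basis_elem) auto

text \<open>Cayley--Hamilton: \<open>x\<close> is a root of the characteristic polynomial of the integral matrix
  of multiplication by \<open>x\<close>.\<close>

lemma algebraic_int_if_stable:
  assumes "\<And>y. y \<in> I \<Longrightarrow> x * y \<in> I"
  shows "algebraic_int x"
proof -
  have "\<exists>m :: int ^ 'n. x * r i = (\<Sum>j\<in>UNIV. of_int (m $ j) * r j)" for i
    using assms[OF field_Z_basis_elem[of i]] field_Z_basis_coords by blast
  then obtain C :: "'n \<Rightarrow> int ^ 'n" where C: "\<And>i. x * r i = (\<Sum>j\<in>UNIV. of_int (C i $ j) * r j)"
    by metis
  define M :: "'a poly ^ 'n ^ 'n" where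
    "M = (\<chi> i j. if i = j then [:- of_int (C i $ j), 1:] else [:- of_int (C i $ j):])"
  define p where "p = det M"
  define t where "t \<pi> = of_int (sign \<pi>) * (\<Prod>i\<in>UNIV. M $ i $ \<pi> i)" for \<pi>
  have p: "p = (\<Sum>\<pi> | \<pi> permutes UNIV. t \<pi>)"
    by (simp add: p_def t_def det_def)
  have degM: "degree (M $ i $ j) = (if i = j then 1 else 0)" for i j
    by (simp add: M_def)
  \<comment> \<open>The identity permutation alone reaches degree \<open>CARD('n)\<close> and makes
    \<open>p\<close> monic; any other permutation picks an off-diagonal entry, which is
    constant.\<close>
  have t_id: "lead_coeff (t id) = 1" "degree (t id) = CARD('n)"
  proof -
    have "degree (\<Prod>i\<in>UNIV. M $ i $ i) = (\<Sum>i\<in>(UNIV::'n set). degree (M $ i $ i))"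
      by (rule degree_prod_eq_sum_degree) (auto simp: M_def)
    then show "degree (t id) = CARD('n)" by (simp add: t_def sign_id degM)
    show "lead_coeff (t id) = 1" by (simp add: t_def sign_id lead_coeff_prod M_def)
  qed
  have t_deg: "degree (t \<pi>) < CARD('n)" if "\<pi> permutes UNIV" "\<pi> \<noteq> id" for \<pi>
  proof -
    from that obtain i where i: "\<pi> i \<noteq> i" by (auto simp: fun_eq_iff)
    have "degree (t \<pi>) \<le> degree (\<Prod>i\<in>UNIV. M $ i $ \<pi> i)"
      using degree_mult_le[of "of_int (sign \<pi>)" "\<Prod>i\<in>UNIV. M $ i $ \<pi> i"] by (simp add: t_def)
    also have "\<dots> \<le> (\<Sum>j\<in>UNIV. degree (M $ j $ \<pi> j))"
      using degree_prod_sum_le[of "UNIV :: 'n set"] by (simp add: comp_def)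
    also have "\<dots> < (\<Sum>j\<in>(UNIV::'n set). 1)"
      by (rule sum_strict_mono_ex1) (use i in \<open>auto simp: degM intro!: exI[of _ i]\<close>)
    finally show ?thesis by simp
  qed
  define q where "q = (\<Sum>\<pi> | \<pi> permutes UNIV \<and> \<pi> \<noteq> id. t \<pi>)"
  have pq: "p = t id + q"
  proof -
    have "{\<pi> :: 'n \<Rightarrow> 'n. \<pi> permutes UNIV} = insert id {\<pi>. \<pi> permutes UNIV \<and> \<pi> \<noteq> id}"
      using permutes_id by auto
    then show ?thesis
      by (simp add: p q_def finite_permutations)
  qed
  have "degree q < CARD('n)"
    unfolding q_def by (rule degree_sum_less) (use t_deg in auto)
  with t_id have "lead_coeff p = 1"
    by (simp add: pq degree_add_eq_left coeff_eq_0)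
  moreover have "\<forall>i. coeff p i \<in> \<int>"
  proof -
    have 1: "coeff (\<Prod>i\<in>S. M $ i $ \<pi> i) j \<in> \<int>" if "finite S" for S j and \<pi> :: "'n \<Rightarrow> 'n"
      using that by (induction S arbitrary: j rule: finite_induct)
        (auto simp: coeff_mult M_def coeff_pCons coeff_1 split: nat.splits intro!: Ints_sum Ints_mult)
    have "coeff (t \<pi>) j \<in> \<int>" for \<pi> j
    proof -
      have "t \<pi> = smult (of_int (sign \<pi>)) (\<Prod>i\<in>UNIV. M $ i $ \<pi> i)"
        by (simp add: t_def of_int_poly)
      then show ?thesis using 1[of UNIV \<pi> j] by (simp add: Ints_mult)
    qed
    then show ?thesis by (simp add: p coeff_sum Ints_sum)
  qed
  moreover have "poly p x = 0"
  proof -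
    define A :: "'a ^ 'n ^ 'n" where "A = (\<chi> i j. poly (M $ i $ j) x)"
    have "poly p x = det A"
      by (simp add: p_def A_def det_def poly_sum poly_prod of_int_poly)
    moreover have "det A = 0"
    proof (rule ccontr)
      assume "det A \<noteq> 0"
      then have inv: "invertible A" by (simp add: invertible_det_nz)
      \<comment> \<open>\<open>A\<close> is \<open>x\<close> minus the integral matrix with rows
        \<open>C i\<close>, and by the choice of \<open>C\<close> the vector of the
        \<open>r i\<close> is an eigenvector of that matrix for \<open>x\<close>.\<close>
      have "A *v (\<chi> i. r i) = 0"
      proof -
        have "(\<Sum>j\<in>UNIV. A $ i $ j * r j) = 0" for i
        proof -
          have "(\<Sum>j\<in>UNIV. A $ i $ j * r j) =
              (\<Sum>j\<in>UNIV. (if i = j then x * r j else 0) - of_int (C i $ j) * r j)"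
            by (intro sum.cong) (auto simp: A_def M_def algebra_simps)
          also have "\<dots> = 0"
            by (simp add: sum_subtractf C[symmetric])
          finally show ?thesis .
        qed
        then show ?thesis by (simp add: vec_eq_iff matrix_vector_mult_def)
      qed
      then have "(\<chi> i. r i) = 0"
        using inv unfolding invertible_left_inverse matrix_left_invertible_ker by blast
      then have "r i = 0" for i by (simp add: vec_eq_iff)
      \<comment> \<open>If all \<open>r i\<close> were 0, the coefficient vectors 1 and 0 would
        represent the same element.\<close>
      then show False
        using field_Z_basis_unique[of "\<lambda>_. 1" "\<lambda>_. 0"] by simp
    qed
    ultimately show ?thesis by simp
  qed
  ultimately show ?thesis by (rule algebraic_int.intros)
qed

end

text \<open>Substituting one expansion into the other and comparing coordinates gives the last
  equation. Its case \<open>i = k\<close> supplies the sum 1 in the uniqueness of orthogonal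
  bases.\<close>

lemma field_Z_basis_change:
  fixes r r' :: "'n::finite \<Rightarrow> 'a::field_char_0"
  assumes r: "field_Z_basis I r" and r': "field_Z_basis I r'"
  obtains C D :: "'n \<Rightarrow> 'n \<Rightarrow> int"
  where "\<And>i. r' i = (\<Sum>j\<in>UNIV. of_int (C i j) * r j)"
    and "\<And>i. r i = (\<Sum>j\<in>UNIV. of_int (D i j) * r' j)"
    and "\<And>i k. (\<Sum>j\<in>UNIV. D i j * C j k) = (if i = k then 1 else 0)"
proof -
  have "\<exists>m :: int ^ 'n. r' i = (\<Sum>j\<in>UNIV. of_int (m $ j) * r j)" for i
    using field_Z_basis_coords[OF r] field_Z_basis_elem[OF r'] by metis
  then obtain C where C: "\<And>i. r' i = (\<Sum>j\<in>UNIV. of_int (C i $ j) * r j)" by metis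
  have "\<exists>m :: int ^ 'n. r i = (\<Sum>j\<in>UNIV. of_int (m $ j) * r' j)" for i
    using field_Z_basis_coords[OF r'] field_Z_basis_elem[OF r] by metis
  then obtain D where D: "\<And>i. r i = (\<Sum>j\<in>UNIV. of_int (D i $ j) * r' j)" by metis
  have "(\<Sum>j\<in>UNIV. D i $ j * C j $ k) = (if i = k then 1 else 0)" for i k
  proof -
    have "(\<Sum>k\<in>UNIV. of_int (if i = k then 1 else 0) * r k) = r i"
      by (simp add: if_distrib[of "\<lambda>x. x * _"] if_distrib[of of_int] cong: if_cong)
    also have "\<dots> = (\<Sum>j\<in>UNIV. \<Sum>k\<in>UNIV. of_int (D i $ j * C j $ k) * r k)"
      by (subst D) (simp add: C sum_distrib_left mult.assoc)
    also have "\<dots> = (\<Sum>k\<in>UNIV. of_int (\<Sum>j\<in>UNIV. D i $ j * C j $ k) * r k)"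
      by (subst sum.swap) (simp add: sum_distrib_right)
    finally show ?thesis
      using field_Z_basis_unique[OF r, of "\<lambda>k. if i = k then 1 else 0" "\<lambda>k. \<Sum>j\<in>UNIV. D i $ j * C j $ k" k]
      by simp
  qed
  then show thesis using that[of "\<lambda>i j. C i $ j" "\<lambda>i j. D i $ j"] C D by blast
qed

lemma rat_common_denominator:
  fixes q :: "'n::finite \<Rightarrow> rat"
  obtains d :: int and m :: "'n \<Rightarrow> int" where "d > 0" "\<And>i. of_int d * q i = of_int (m i)"
proof -
  define den where "den i = snd (quotient_of (q i))" for i
  define num where "num i = fst (quotient_of (q i))" for i
  have den: "den i > 0" for i by (simp add: den_def quotient_of_denom_pos')
  have q: "q i = of_int (num i) / of_int (den i)" for i
    by (simp add: num_def den_def quotient_of_div)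
  define d where "d = (\<Prod>i\<in>UNIV. den i)"
  have "of_int d * q i = of_int (num i * (\<Prod>j\<in>UNIV - {i}. den j))" for i
    using den[of i] by (simp add: q d_def prod.remove[of UNIV i])
  moreover have "d > 0" by (simp add: d_def den prod_pos)
  ultimately show thesis
    using that[of d "\<lambda>i. num i * (\<Prod>j\<in>UNIV - {i}. den j)"] by blast
qed

section \<open>The embedded lattice as a point of the space of lattices\<close>

context real_embeddings
begin

text \<open>Clearing denominators makes a rational relation integral, and an integral relation
  between members of a basis of \<open>I\<close> is trivial; the degree turns independence into
  spanning.\<close>

lemma field_Z_basis_imp_rat_basis:
  assumes "field_Z_basis I r"
  shows "rat_basis r"
proof (rule independent_imp_rat_basis, rule allI)
  fix q :: "'n \<Rightarrow> rat" and i
  assume q: "(\<Sum>i\<in>UNIV. of_rat (q i) * r i) = 0"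
  obtain d and m :: "'n \<Rightarrow> int" where d: "d > 0" and m: "\<And>i. of_int d * q i = of_int (m i)"
    using rat_common_denominator[of q] by blast
  have "of_int d * (of_rat (q i) :: 'a) = of_int (m i)" for i
    by (metis m of_rat_mult of_rat_of_int_eq)
  then have "(\<Sum>i\<in>UNIV. of_int (m i) * r i) = of_int d * (\<Sum>i\<in>UNIV. of_rat (q i) * r i)"
    by (simp add: sum_distrib_left flip: mult.assoc)
  then have "(\<Sum>i\<in>UNIV. of_int (m i) * r i) = (\<Sum>i\<in>UNIV. of_int ((\<lambda>_. 0) i) * r i)"
    by (simp add: q)
  from field_Z_basis_unique[OF assms this] have "m i = 0" .
  with m[of i] d show "q i = 0" by simp
qed

lemma embed_sum_of_int:
  "embed \<sigma> (\<Sum>i\<in>UNIV. of_int (m $ i) * r i) = of_int_vec m v* emb_matrix r"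
  by (simp add: vec_eq_iff embed_def vector_matrix_mult_def)

lemma row_lattice_emb_matrix:
  assumes "field_Z_basis I r"
  shows "row_lattice (emb_matrix r) = embed \<sigma> ` I"
proof -
  have "I = range (\<lambda>m :: int ^ 'n. \<Sum>i\<in>UNIV. of_int (m $ i) * r i)"
    using assms by (auto simp: Z_basis_def bij_betw_def)
  then show ?thesis
    by (simp add: row_lattice_alt image_image embed_sum_of_int)
qed

lemma lattice_point_nonempty:
  assumes "field_Z_basis I (r :: 'n \<Rightarrow> 'a)"
  shows "lattice_point \<sigma> I \<noteq> {}"
proof -
  define R where "R = emb_matrix r"
  have R: "det R \<noteq> 0"
    using emb_matrix_invertible[OF field_Z_basis_imp_rat_basis[OF assms]]
    by (simp add: R_def invertible_det_nz)
  have "\<exists>E :: int ^ 'n ^ 'n. E ** E = mat 1 \<and> det (of_int_mat E ** R) > 0"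
  proof (cases "det R > 0")
    case True
    then show ?thesis by (intro exI[of _ "mat 1"]) simp
  next
    case False
    fix a :: 'n
    \<comment> \<open>\<open>E\<close> flips the sign of the basis vector with index
      \<open>a\<close>: this reverses the orientation but keeps the lattice, since \<open>E\<close>
      is its own inverse.\<close>
    define E :: "int ^ 'n ^ 'n" where
      "E = (\<chi> i j. if i = j then (if i = a then - 1 else 1) else 0)"
    have "det E = (\<Prod>i\<in>UNIV. if i = a then - 1 else 1)"
      by (subst det_diagonal) (auto simp: E_def)
    then have "det E = - 1" by simp
    with False R have "det (of_int_mat E ** R) > 0"
      by (simp add: det_mul det_of_int_mat)
    moreover have "E ** E = mat 1"
      by (auto simp: E_def matrix_matrix_mult_def mat_def vec_eq_iff
          if_distrib[of "\<lambda>x. x * _"] cong: if_cong)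
    ultimately show ?thesis by blast
  qed
  then obtain E :: "int ^ 'n ^ 'n" where E: "E ** E = mat 1" "det (of_int_mat E ** R) > 0"
    by blast
  define d where "d = det (of_int_mat E ** R)"
  \<comment> \<open>Scaling by \<open>c\<close> multiplies the determinant by
    \<open>c ^ CARD('n)\<close>, which brings the covolume from \<open>d\<close> to 1.\<close>
  define c where "c = root CARD('n) (1 / d)"
  have c: "c > 0" "c ^ CARD('n) = 1 / d"
    using E(2) by (simp_all add: c_def d_def)
  have "c *\<^sub>R (of_int_mat E ** R) \<in> lattice_point \<sigma> I"
    using c E(2) unfolding lattice_point_def SLR_def
    by (auto simp: det_scaleR row_lattice_scaleR row_lattice_int_mult[OF E(1)] R_def
        row_lattice_emb_matrix[OF assms] image_image d_def)
  then show ?thesis by blast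
qed

end

section \<open>Orthogonal bases\<close>

text \<open>Serves for two injections: the embedding of \<open>I\<close> in Euclidean space deformed
  by a matrix, and multiplication by a unit.\<close>

lemma Z_basis_image_iff:
  fixes b :: "'n::finite \<Rightarrow> 'v::comm_monoid_add" and T :: "'v \<Rightarrow> 'w::comm_monoid_add"
  assumes "inj T"
    and "\<And>m :: int ^ 'n. T (\<Sum>i\<in>UNIV. scl (m $ i) (b i)) = (\<Sum>i\<in>UNIV. scl' (m $ i) (T (b i)))"
  shows "Z_basis scl' (T ` L) (\<lambda>i. T (b i)) \<longleftrightarrow> Z_basis scl L b"
proof -
  define g where "g = (\<lambda>m :: int ^ 'n. \<Sum>i\<in>UNIV. scl (m $ i) (b i))"
  have "Z_basis scl' (T ` L) (\<lambda>i. T (b i)) \<longleftrightarrow> bij_betw (T \<circ> g) UNIV (T ` L)"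
    by (simp add: Z_basis_def g_def comp_def assms(2))
  also have "\<dots> \<longleftrightarrow> inj g \<and> range g = L"
    using assms(1) by (auto simp: bij_betw_def inj_image_eq_iff simp flip: image_image image_comp
        intro: inj_compose inj_on_imageI2)
  finally show ?thesis by (simp add: Z_basis_def bij_betw_def g_def)
qed

lemma inner_vector_matrix_orthogonal:
  fixes K :: "real ^ 'n ^ 'n"
  assumes "orthogonal_matrix K"
  shows "(x v* K) \<bullet> (y v* K) = x \<bullet> y"
proof -
  have "(x v* K) \<bullet> (y v* K) = x \<bullet> (K *v (transpose K *v y))"
    by (simp add: dot_lmul_matrix)
  also have "\<dots> = x \<bullet> y"
    using assms by (simp only: matrix_vector_mul_assoc orthogonal_matrix_def matrix_vector_mul_lid)
  finally show ?thesis .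
qed

lemma inj_vector_matrix_mult:
  fixes A :: "real ^ 'n ^ 'n"
  assumes "invertible A"
  shows "inj (\<lambda>v. v v* A)"
proof -
  obtain B where "A ** B = mat 1" using assms by (auto simp: invertible_def)
  then show ?thesis
    by (intro inj_on_inverseI[of _ "\<lambda>v. v v* B"]) (simp add: vector_matrix_mul_assoc)
qed

lemma det_SLZ: "C \<in> SLZ \<Longrightarrow> det C = 1"
  by (simp add: SLZ_def SLR_def)

lemma pos_diag_offdiag: "A \<in> pos_diag \<Longrightarrow> i \<noteq> j \<Longrightarrow> A $ i $ j = 0"
  by (simp add: pos_diag_def)

lemma pos_diag_pos: "A \<in> pos_diag \<Longrightarrow> A $ i $ i > 0"
  by (simp add: pos_diag_def)

lemma det_pos_diag: "A \<in> pos_diag \<Longrightarrow> det A = 1"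
  by (simp add: pos_diag_def SLR_def)

lemma prod_pos_diag: "A \<in> pos_diag \<Longrightarrow> (\<Prod>i\<in>UNIV. A $ i $ i) = 1"
  using det_diagonal[of A] det_pos_diag[of A] pos_diag_offdiag[of A] by simp

lemma vector_pos_diag_nth:
  assumes "A \<in> pos_diag"
  shows "(v v* A) $ k = v $ k * A $ k $ k"
proof -
  have "(v v* A) $ k = (\<Sum>i\<in>UNIV. if i = k then v $ k * A $ k $ k else 0)"
    unfolding vector_matrix_mult_def vec_lambda_beta
    by (rule sum.cong) (auto simp: pos_diag_offdiag[OF assms])
  then show ?thesis by simp
qed

section \<open>The quadratic form of a diagonal matrix and its orthogonal bases\<close>

context real_embeddings
begin

lemma embed_add: "embed \<sigma> (x + y) = embed \<sigma> x + embed \<sigma> y"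
  by (simp add: embed_def vec_eq_iff)

lemma embed_of_int_mult: "embed \<sigma> (of_int m * x) = of_int m *\<^sub>R embed \<sigma> x"
  by (simp add: embed_def vec_eq_iff)

lemma embed_0: "embed \<sigma> 0 = 0"
  by (simp add: embed_def vec_eq_iff)

lemma embed_sum: "embed \<sigma> (\<Sum>i\<in>S. f i) = (\<Sum>i\<in>S. embed \<sigma> (f i))"
  by (simp add: embed_def vec_eq_iff)

lemma inj_embed: "inj (embed \<sigma>)"
  by (auto simp: inj_def embed_def vec_eq_iff)

lemma embed_diag_embed: "embed \<sigma> x v* diag_embed \<sigma> y = embed \<sigma> (y * x)"
  by (simp add: vec_eq_iff vector_matrix_mult_def embed_def if_distrib[of "\<lambda>x. _ * x"]
      mult.commute cong: if_cong)

lemma diag_embed_mult: "diag_embed \<sigma> x ** diag_embed \<sigma> y = diag_embed \<sigma> (x * y)"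
  by (auto simp: vec_eq_iff matrix_matrix_mult_def if_distrib[of "\<lambda>x. x * _"] cong: if_cong)

lemma diag_embed_1: "diag_embed \<sigma> 1 = mat 1"
  by (simp add: vec_eq_iff mat_def)

lemma det_diag_embed: "det (diag_embed \<sigma> x) = (\<Prod>k\<in>UNIV. \<sigma> k x)"
  by (subst det_diagonal) auto

text \<open>The Euclidean inner product pulled back to the field along the embedding followed by
  \<open>A\<close>; for diagonal \<open>A\<close> it is the trace form weighted by the squares of
  the diagonal entries.\<close>

definition qf :: "real ^ 'n ^ 'n \<Rightarrow> 'a \<Rightarrow> 'a \<Rightarrow> real" where
  "qf A x y = (embed \<sigma> x v* A) \<bullet> (embed \<sigma> y v* A)"

definition orth_basis :: "'a set \<Rightarrow> real ^ 'n ^ 'n \<Rightarrow> ('n \<Rightarrow> 'a) \<Rightarrow> bool" where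
  "orth_basis I A r \<longleftrightarrow> field_Z_basis I r \<and> (\<forall>i j. i \<noteq> j \<longrightarrow> qf A (r i) (r j) = 0)"

lemma orth_basis_iff:
  "orth_basis I A r \<longleftrightarrow> field_Z_basis I r \<and>
     pairwise (\<lambda>i j. orthogonal (embed \<sigma> (r i) v* A) (embed \<sigma> (r j) v* A)) UNIV"
  by (simp add: orth_basis_def pairwise_def orthogonal_def qf_def)

lemma qf_commute: "qf A x y = qf A y x"
  by (simp add: qf_def inner_commute)

lemma qf_sum_left:
  "qf A (\<Sum>j\<in>S. of_int (m j) * x j) y = (\<Sum>j\<in>S. of_int (m j) * qf A (x j) y)"
proof (induction S rule: infinite_finite_induct)
  case (insert j S)
  then show ?case
    by (simp add: qf_def embed_add embed_of_int_mult vector_matrix_left_distrib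
        inner_add_left scaleR_vector_matrix_assoc)
qed (simp_all add: qf_def embed_0)

lemma qf_pos:
  assumes "A \<in> pos_diag" "x \<noteq> 0"
  shows "qf A x x > 0"
proof -
  fix k :: 'n
  have "(embed \<sigma> x v* A) $ k \<noteq> 0"
    using assms pos_diag_pos[of A k] by (simp add: vector_pos_diag_nth embed_def)
  then have "embed \<sigma> x v* A \<noteq> 0" by auto
  then show ?thesis by (simp add: qf_def)
qed

lemma qf_pos_diag:
  assumes "A \<in> pos_diag"
  shows "qf A x y = (\<Sum>k\<in>UNIV. (A $ k $ k)\<^sup>2 * \<sigma> k x * \<sigma> k y)"
  by (simp add: qf_def inner_vec_def vector_pos_diag_nth[OF assms] embed_def power2_eq_square
      algebra_simps)

lemma dual_basis_nonzero:
  fixes r s :: "'n \<Rightarrow> 'a"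
  assumes "dual_basis r s"
  shows "r i \<noteq> 0" "s i \<noteq> 0"
proof -
  have "(\<Sum>k\<in>UNIV. \<sigma> k (r i) * \<sigma> k (s i)) = 1" using assms by (simp add: dual_basis_iff)
  then show "r i \<noteq> 0" "s i \<noteq> 0" by auto
qed

text \<open>As functions of \<open>k\<close>, both sides have the same pairing with every
  \<open>r i\<close>, by orthogonality on the left and duality on the right. Since
  \<open>emb_matrix r\<close> has trivial kernel, they agree in each coordinate.\<close>

lemma orth_basis_dual:
  assumes A: "A \<in> pos_diag" and r: "orth_basis I A r" and s: "dual_basis r s"
  shows "(A $ k $ k)\<^sup>2 * \<sigma> k (r j) = qf A (r j) (r j) * \<sigma> k (s j)"
proof -
  have "rat_basis r"
    using r field_Z_basis_imp_rat_basis unfolding orth_basis_def by blast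
  moreover have "(\<Sum>k\<in>UNIV. \<sigma> k (r i) *
      ((A $ k $ k)\<^sup>2 * \<sigma> k (r j) - qf A (r j) (r j) * \<sigma> k (s j))) = 0" for i
  proof -
    have "(\<Sum>k\<in>UNIV. \<sigma> k (r i) * ((A $ k $ k)\<^sup>2 * \<sigma> k (r j) - qf A (r j) (r j) * \<sigma> k (s j))) =
        qf A (r i) (r j) - qf A (r j) (r j) * (\<Sum>k\<in>UNIV. \<sigma> k (r i) * \<sigma> k (s j))"
      by (simp add: qf_pos_diag[OF A, of "r i" "r j"] sum_subtractf sum_distrib_left
          right_diff_distrib ac_simps)
    also have "\<dots> = 0"
      using r s by (auto simp: orth_basis_def dual_basis_iff)
    finally show ?thesis .
  qed
  ultimately have "(A $ k $ k)\<^sup>2 * \<sigma> k (r j) - qf A (r j) (r j) * \<sigma> k (s j) = 0"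
    by (rule emb_matrix_ker)
  then show ?thesis by simp
qed

lemma orth_basis_imp_rp:
  assumes A: "A \<in> pos_diag" and r: "orth_basis I A r"
  shows "r \<in> rp_bases I"
proof -
  have Z: "field_Z_basis I r" using r by (simp add: orth_basis_def)
  obtain s where s: "dual_basis r s"
    by (rule dual_basis_exists[OF field_Z_basis_imp_rat_basis[OF Z]])
  note nz = dual_basis_nonzero[OF s]
  define l where "l i = qf A (r i) (r i)" for i
  have l: "l i > 0" for i unfolding l_def by (rule qf_pos[OF A nz(1)])
  have quot: "\<sigma> k (r i / s i) = l i / (A $ k $ k)\<^sup>2" for i k
    using orth_basis_dual[OF A r s, of k i] nz(2)[of i] pos_diag_pos[OF A, of k]
    by (simp add: l_def field_simps)
  have "\<exists>q :: rat. q > 0 \<and> (r i / s i) / (r j / s j) = of_rat q" for i j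
  proof -
    have "\<sigma> k ((r i / s i) / (r j / s j)) = l i / l j" for k
      unfolding sigma_divide[of k "r i / s i"] quot using pos_diag_pos[OF A, of k] by simp
    then obtain q where q: "(r i / s i) / (r j / s j) = of_rat q" "l i / l j = of_rat q"
      by (rule eq_of_rat_if_sigma_const)
    moreover from q(2) have "q > 0"
      using l[of i] l[of j] by (metis divide_pos_pos zero_less_of_rat_iff)
    ultimately show ?thesis by blast
  qed
  with s Z show ?thesis by (auto simp: rp_bases_def rational_positive_def)
qed

text \<open>For a rational and positive basis, the form \<open>\<Sum>k. z\<^sub>k\<^sup>2 / \<sigma>\<^sub>k (r i / s i)\<close>
  is diagonal with positive entries in the basis \<open>r\<close>; hence its coefficients are positive, and
  their square roots give the diagonal matrix.\<close>

lemma rp_imp_orth_basis: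
  assumes "r \<in> rp_bases I"
  obtains A where "A \<in> pos_diag" "orth_basis I A r"
proof -
  have Z: "field_Z_basis I r" using assms by (simp add: rp_bases_def)
  obtain s where s: "dual_basis r s"
    and rp: "\<And>i j. i \<noteq> j \<Longrightarrow> \<exists>q :: rat. q > 0 \<and> (r i / s i) / (r j / s j) = of_rat q"
    using assms by (auto simp: rp_bases_def rational_positive_def)
  note nz = dual_basis_nonzero[OF s]
  fix a :: 'n
  \<comment> \<open>The index \<open>a\<close> normalises the common factor: every
    \<open>r i / s i\<close> is a positive rational multiple of \<open>r a / s a\<close>, the
    inverse of \<open>t\<close>. The squares of the diagonal entries will be proportional to the
    \<open>\<sigma> k t\<close>.\<close>
  define t where "t = s a / r a"
  have t: "t \<noteq> 0" by (simp add: t_def nz)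
  have "\<exists>q :: rat. q > 0 \<and> t * r i = of_rat q * s i" for i
  proof (cases "i = a")
    case True
    then show ?thesis by (intro exI[of _ 1]) (simp add: t_def nz)
  next
    case False
    then obtain q where q: "q > 0" "(r i / s i) / (r a / s a) = of_rat q" using rp by blast
    from q(2) have "t * r i = of_rat q * s i"
      using nz[of i] nz[of a] by (simp add: t_def field_simps)
    with q(1) show ?thesis by blast
  qed
  then obtain q where q: "\<And>i. q i > 0" "\<And>i. t * r i = of_rat (q i) * s i" by metis
  have form: "(\<Sum>k\<in>UNIV. \<sigma> k t * \<sigma> k (r i) * \<sigma> k (r j)) = (if i = j then of_rat (q i) else 0)" for i j
  proof -
    have "\<sigma> k t * \<sigma> k (r i) * \<sigma> k (r j) = of_rat (q j) * (\<sigma> k (r i) * \<sigma> k (s j))" for k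
      using arg_cong[OF q(2)[of j], of "\<sigma> k"] by (simp add: algebra_simps)
    then have "(\<Sum>k\<in>UNIV. \<sigma> k t * \<sigma> k (r i) * \<sigma> k (r j)) =
        of_rat (q j) * (\<Sum>k\<in>UNIV. \<sigma> k (r i) * \<sigma> k (s j))"
      by (simp only: sum_distrib_left)
    then show ?thesis using s by (simp add: dual_basis_iff)
  qed
  have pos: "\<sigma> l t > 0" for l
  proof -
    obtain S where S: "S ** emb_matrix r = mat 1"
      using emb_matrix_invertible[OF field_Z_basis_imp_rat_basis[OF Z]]
      by (auto simp: invertible_def)
    \<comment> \<open>With these coefficients the embedded \<open>r i\<close> combine to the
      coordinate vector of index \<open>l\<close>, where the form takes the value
      \<open>\<sigma> l t\<close>; in the basis \<open>r\<close> that value is a sum of squares with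
      positive weights.\<close>
    define y where "y i = S $ l $ i" for i
    have y: "(\<Sum>i\<in>UNIV. y i * \<sigma> k (r i)) = (if k = l then 1 else 0)" for k
      using arg_cong[OF S, of "\<lambda>M. M $ l $ k"]
      by (auto simp: matrix_matrix_mult_def mat_def y_def)
    have "\<sigma> l t = (\<Sum>k\<in>UNIV. \<sigma> k t * (\<Sum>i\<in>UNIV. y i * \<sigma> k (r i)) * (\<Sum>j\<in>UNIV. y j * \<sigma> k (r j)))"
      by (simp add: y if_distrib[of "\<lambda>x. _ * x"] cong: if_cong)
    also have "\<dots> = (\<Sum>k\<in>UNIV. \<Sum>i\<in>UNIV. \<Sum>j\<in>UNIV. y i * y j * (\<sigma> k t * \<sigma> k (r i) * \<sigma> k (r j)))"
      by (simp add: sum_distrib_left sum_distrib_right algebra_simps)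
    also have "\<dots> = (\<Sum>i\<in>UNIV. \<Sum>k\<in>UNIV. \<Sum>j\<in>UNIV. y i * y j * (\<sigma> k t * \<sigma> k (r i) * \<sigma> k (r j)))"
      by (rule sum.swap)
    also have "\<dots> = (\<Sum>i\<in>UNIV. \<Sum>j\<in>UNIV. \<Sum>k\<in>UNIV. y i * y j * (\<sigma> k t * \<sigma> k (r i) * \<sigma> k (r j)))"
      by (rule sum.cong[OF refl], rule sum.swap)
    also have "\<dots> = (\<Sum>i\<in>UNIV. \<Sum>j\<in>UNIV. if j = i then (y i)\<^sup>2 * of_rat (q i) else 0)"
      unfolding sum_distrib_left[symmetric] form
      by (intro sum.cong refl) (simp add: power2_eq_square)
    also have "\<dots> = (\<Sum>i\<in>UNIV. (y i)\<^sup>2 * of_rat (q i))" by simp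
    also have "\<dots> > 0"
    proof -
      have "(\<Sum>i\<in>UNIV. y i * \<sigma> l (r i)) \<noteq> 0" by (simp add: y)
      then obtain i where "y i \<noteq> 0"
        by (elim sum.not_neutral_contains_not_neutral) auto
      then have "(y i)\<^sup>2 * of_rat (q i) > 0" using q(1)[of i] by simp
      moreover have "(y i)\<^sup>2 * of_rat (q i) \<ge> 0" for i
        using q(1)[of i] by (intro mult_nonneg_nonneg) (simp_all add: less_imp_le)
      ultimately show ?thesis by (intro sum_pos2[of _ i]) auto
    qed
    finally show ?thesis .
  qed
  define P where "P = (\<Prod>k\<in>UNIV. sqrt (\<sigma> k t))"
  \<comment> \<open>The common factor that brings the determinant to 1.\<close>
  define c where "c = root CARD('n) (1 / P)"
  have P: "P > 0" unfolding P_def by (intro prod_pos) (simp add: pos)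
  then have c: "c > 0" "c ^ CARD('n) = 1 / P" by (simp_all add: c_def)
  define A :: "real ^ 'n ^ 'n" where "A = (\<chi> i j. if i = j then c * sqrt (\<sigma> i t) else 0)"
  have "det A = (\<Prod>i\<in>UNIV. c * sqrt (\<sigma> i t))"
    by (subst det_diagonal) (auto simp: A_def)
  also have "\<dots> = 1"
    using P c by (simp add: prod.distrib P_def t)
  finally have "det A = 1" .
  then have A: "A \<in> pos_diag"
    using c pos by (simp add: pos_diag_def SLR_def A_def)
  have "(A $ k $ k)\<^sup>2 = c\<^sup>2 * \<sigma> k t" for k
    using pos[of k] by (simp add: A_def power_mult_distrib)
  then have "qf A x y = c\<^sup>2 * (\<Sum>k\<in>UNIV. \<sigma> k t * \<sigma> k x * \<sigma> k y)" for x y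
    by (simp add: qf_pos_diag[OF A] sum_distrib_left mult.assoc)
  then have "orth_basis I A r"
    by (simp add: orth_basis_def Z form)
  with A show thesis by (rule that)
qed

text \<open>By \<open>orth_basis_dual\<close> at one index \<open>a\<close>, the squared diagonal
  entries of both matrices are positive multiples of the same numbers
  \<open>\<sigma> k (s a / r a)\<close>. So the matrices are proportional, and determinant one
  leaves only the positive factor 1.\<close>

lemma orth_basis_determines_pos_diag:
  assumes A: "A \<in> pos_diag" "orth_basis I A r" and A': "A' \<in> pos_diag" "orth_basis I A' r"
  shows "A = A'"
proof -
  have Z: "field_Z_basis I r" using A by (simp add: orth_basis_def)
  obtain s where s: "dual_basis r s"
    by (rule dual_basis_exists[OF field_Z_basis_imp_rat_basis[OF Z]])
  note nz = dual_basis_nonzero[OF s]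
  fix a :: 'n
  define l where "l = qf A (r a) (r a)"
  define l' where "l' = qf A' (r a) (r a)"
  have l: "l > 0" "l' > 0"
    unfolding l_def l'_def by (rule qf_pos[OF A(1) nz(1)] qf_pos[OF A'(1) nz(1)])+
  define c where "c = sqrt (l / l')"
  have c: "c > 0" using l by (simp add: c_def)
  have Ak: "A $ k $ k = c * A' $ k $ k" for k
  proof -
    have "l' * ((A $ k $ k)\<^sup>2 * \<sigma> k (r a)) = l * ((A' $ k $ k)\<^sup>2 * \<sigma> k (r a))"
      unfolding orth_basis_dual[OF A s] orth_basis_dual[OF A' s] l_def l'_def by simp
    then have "(A $ k $ k)\<^sup>2 = (c * A' $ k $ k)\<^sup>2"
      using nz(1)[of a] l by (simp add: c_def power_mult_distrib field_simps)
    moreover have "0 \<le> A $ k $ k" "0 \<le> c * A' $ k $ k"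
      using c pos_diag_pos[OF A(1), of k] pos_diag_pos[OF A'(1), of k] by simp_all
    ultimately show ?thesis by (rule power2_eq_imp_eq)
  qed
  then have "c ^ CARD('n) = 1"
    using prod_pos_diag[OF A(1)] prod_pos_diag[OF A'(1)] by (simp add: prod.distrib)
  then have "c = 1" using c power_eq_imp_eq_base[of c "CARD('n)" 1] by simp
  with Ak pos_diag_offdiag[OF A(1)] pos_diag_offdiag[OF A'(1)] show ?thesis
    unfolding vec_eq_iff by (metis mult_1)
qed

text \<open>An orthogonal basis of a lattice is unique up to signs and order: the change-of-basis
  matrices \<open>C\<close>, \<open>D\<close> satisfy \<open>D i j * l j = C j i * l' i\<close> with positive \<open>l\<close>, \<open>l'\<close>,
  so the integers \<open>D i j * C j i\<close> are nonnegative with sum \<open>1\<close>.\<close>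

lemma orth_basis_unique:
  assumes A: "A \<in> pos_diag" and r: "orth_basis I A r" and r': "orth_basis I A r'"
  obtains \<eta> :: "'n \<Rightarrow> 'a" and \<pi> :: "'n \<Rightarrow> 'n"
  where "range \<eta> \<subseteq> {1, -1}" "bij \<pi>" "\<And>i. r' i = \<eta> i * r (\<pi> i)"
proof -
  have Z: "field_Z_basis I r" "field_Z_basis I r'" using r r' by (simp_all add: orth_basis_def)
  obtain C D :: "'n \<Rightarrow> 'n \<Rightarrow> int" where C: "\<And>i. r i = (\<Sum>j\<in>UNIV. of_int (C i j) * r' j)"
    and D: "\<And>i. r' i = (\<Sum>j\<in>UNIV. of_int (D i j) * r j)"
    and DC: "\<And>i k. (\<Sum>j\<in>UNIV. D i j * C j k) = (if i = k then 1 else 0)"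
    using field_Z_basis_change[OF Z(2) Z(1)] by blast
  have nz: "r i \<noteq> 0" "r' i \<noteq> 0" for i
    using dual_basis_exists field_Z_basis_imp_rat_basis Z dual_basis_nonzero by metis+
  define l where "l i = qf A (r i) (r i)" for i
  define l' where "l' i = qf A (r' i) (r' i)" for i
  have l: "l i > 0" "l' i > 0" for i
    by (simp_all add: l_def l'_def qf_pos[OF A] nz)
  have 1: "qf A (r' i) (r j) = of_int (D i j) * l j" for i j
  proof -
    have "qf A (r' i) (r j) = (\<Sum>k\<in>UNIV. of_int (D i k) * qf A (r k) (r j))"
      by (subst D) (rule qf_sum_left)
    also have "\<dots> = (\<Sum>k\<in>UNIV. if k = j then of_int (D i j) * l j else 0)"
      using r by (intro sum.cong) (auto simp: orth_basis_def l_def)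
    finally show ?thesis by simp
  qed
  have 2: "qf A (r j) (r' i) = of_int (C j i) * l' i" for i j
  proof -
    have "qf A (r j) (r' i) = (\<Sum>k\<in>UNIV. of_int (C j k) * qf A (r' k) (r' i))"
      by (subst C) (rule qf_sum_left)
    also have "\<dots> = (\<Sum>k\<in>UNIV. if k = i then of_int (C j i) * l' i else 0)"
      using r' by (intro sum.cong) (auto simp: orth_basis_def l'_def)
    finally show ?thesis by simp
  qed
  have sym: "of_int (D i j) * l j = of_int (C j i) * l' i" for i j
    using 1[of i j] 2[of j i] qf_commute[of A "r' i" "r j"] by simp
  \<comment> \<open>Multiplying \<open>sym\<close> by \<open>D i j\<close> produces a square, which
    fixes the sign of the product \<open>D i j * C j i\<close>.\<close>
  have sq: "of_int (D i j * C j i) * l' i = (of_int (D i j))\<^sup>2 * l j" for i j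
    using sym[of i j] by (simp add: power2_eq_square)
  have nonneg: "D i j * C j i \<ge> 0" for i j
  proof -
    have "of_int (D i j * C j i) * l' i \<ge> 0"
      unfolding sq using l[of j] by simp
    then show ?thesis using l(2)[of i] by (simp add: zero_le_mult_iff flip: of_int_mult)
  qed
  have D0: "D i j = 0" if "D i j * C j i = 0" for i j
    using sq[of i j] that l(1)[of j] by simp
  have "\<exists>j. (D i j = 1 \<or> D i j = - 1) \<and> (\<forall>k. k \<noteq> j \<longrightarrow> D i k = 0)" for i
  proof -
    have sum1: "(\<Sum>j\<in>UNIV. D i j * C j i) = 1" using DC[of i i] by simp
    then have "(\<Sum>j\<in>UNIV. D i j * C j i) \<noteq> 0" by simp
    then obtain j where j: "D i j * C j i \<noteq> 0"
      by (elim sum.not_neutral_contains_not_neutral) auto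
    with nonneg[of i j] have ge: "D i j * C j i \<ge> 1" by linarith
    have sum2: "(\<Sum>j\<in>UNIV. D i j * C j i) = D i j * C j i + (\<Sum>k\<in>UNIV - {j}. D i k * C k i)"
      by (rule sum.remove) auto
    have "(\<Sum>k\<in>UNIV - {j}. D i k * C k i) \<ge> 0" by (intro sum_nonneg) (rule nonneg)
    with sum1 sum2 ge have eq: "D i j * C j i = 1" "(\<Sum>k\<in>UNIV - {j}. D i k * C k i) = 0"
      by linarith+
    from eq(2) have "\<forall>k\<in>UNIV - {j}. D i k * C k i = 0"
      using nonneg by (subst (asm) sum_nonneg_eq_0_iff) auto
    \<comment> \<open>\<open>D0\<close> passes from a vanishing product to a vanishing entry of
      \<open>D\<close>; the remaining product is 1, so its integer factors are both 1 or both
      -1.\<close>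
    then have "\<forall>k. k \<noteq> j \<longrightarrow> D i k = 0" using D0 by auto
    with eq(1) show ?thesis by (metis pos_zmult_eq_1_iff_lemma)
  qed
  then obtain \<pi> where \<pi>: "\<And>i. D i (\<pi> i) = 1 \<or> D i (\<pi> i) = - 1" "\<And>i k. k \<noteq> \<pi> i \<Longrightarrow> D i k = 0"
    by metis
  define \<eta> :: "'n \<Rightarrow> 'a" where "\<eta> i = of_int (D i (\<pi> i))" for i
  have \<eta>: "\<eta> i = 1 \<or> \<eta> i = - 1" for i using \<pi>(1)[of i] by (auto simp: \<eta>_def)
  have eq: "r' i = \<eta> i * r (\<pi> i)" for i
  proof -
    have "r' i = (\<Sum>j\<in>UNIV. if j = \<pi> i then \<eta> i * r (\<pi> i) else 0)"
      by (subst D, intro sum.cong) (auto simp: \<eta>_def \<pi>(2))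
    then show ?thesis by simp
  qed
  have "inj \<pi>"
  proof (rule injI, rule ccontr)
    \<comment> \<open>If \<open>\<pi> i = \<pi> j\<close>, then \<open>r' i\<close> and
      \<open>r' j\<close> agree up to sign and cannot be orthogonal.\<close>
    fix i j assume ij: "\<pi> i = \<pi> j" "i \<noteq> j"
    have "qf A (r' i) (r (\<pi> j)) \<noteq> 0"
      using 1[of i "\<pi> i"] \<pi>(1)[of i] l(1)[of "\<pi> i"] by (auto simp: ij(1))
    moreover have "r (\<pi> j) = of_int (D j (\<pi> j)) * r' j"
      using \<eta>[of j] by (auto simp: eq[of j] \<eta>_def[symmetric])
    ultimately have "qf A (of_int (D j (\<pi> j)) * r' j) (r' i) \<noteq> 0"
      by (simp add: qf_commute)
    then have "qf A (r' j) (r' i) \<noteq> 0"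
      using qf_sum_left[of A "\<lambda>_. D j (\<pi> j)" "\<lambda>_. r' j" "{j}" "r' i"] by auto
    then show False using r' ij(2) by (auto simp: orth_basis_def)
  qed
  then have "bij \<pi>" by (simp add: bij_def finite_UNIV_inj_surj)
  with \<eta> eq that show thesis by blast
qed

section \<open>Units and the immersed torus\<close>

text \<open>Since \<open>\<epsilon>\<close> and its inverse both map \<open>I\<close> into itself,
  \<open>algebraic_int_if_stable\<close> applies to each, so the integrality conditions of
  \<open>unit_group\<close> follow from the equation for \<open>I\<close>.\<close>

lemma unit_groupI:
  fixes r :: "'n \<Rightarrow> 'a"
  assumes r: "field_Z_basis I r" and nz: "\<epsilon> \<noteq> 0" and pos: "\<And>k. \<sigma> k \<epsilon> > 0"
    and im: "(*) \<epsilon> ` I = I"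
  shows "\<epsilon> \<in> unit_group \<sigma> I"
proof -
  have "inverse \<epsilon> * y \<in> I" if y: "y \<in> I" for y
  proof -
    have "y \<in> (*) \<epsilon> ` I" using y im by simp
    then obtain z where "z \<in> I" "y = \<epsilon> * z" by blast
    with nz show ?thesis by (simp flip: mult.assoc)
  qed
  moreover have "\<epsilon> * y \<in> I" if "y \<in> I" for y
    using that im by auto
  ultimately show ?thesis
    using nz pos im algebraic_int_if_stable[OF r] by (auto simp: unit_group_def)
qed

lemma unit_group_image: "\<epsilon> \<in> unit_group \<sigma> I \<Longrightarrow> (*) \<epsilon> ` I = I"
  and unit_group_pos: "\<epsilon> \<in> unit_group \<sigma> I \<Longrightarrow> \<sigma> k \<epsilon> > 0"
  and unit_group_nonzero: "\<epsilon> \<in> unit_group \<sigma> I \<Longrightarrow> \<epsilon> \<noteq> 0"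
  by (simp_all add: unit_group_def)

lemma unit_group_1: "1 \<in> unit_group \<sigma> I"
  by (simp add: unit_group_def)

lemma unit_group_mult:
  fixes r :: "'n \<Rightarrow> 'a"
  assumes "field_Z_basis I r" "\<epsilon> \<in> unit_group \<sigma> I" "\<delta> \<in> unit_group \<sigma> I"
  shows "\<epsilon> * \<delta> \<in> unit_group \<sigma> I"
proof (rule unit_groupI[OF assms(1)])
  have "(*) (\<epsilon> * \<delta>) ` I = (*) \<epsilon> ` ((*) \<delta> ` I)"
    by (simp add: image_image mult.assoc)
  then show "(*) (\<epsilon> * \<delta>) ` I = I"
    using assms by (simp add: unit_group_image)
qed (use assms in \<open>simp_all add: unit_group_pos unit_group_nonzero\<close>)

lemma unit_group_inverse:
  fixes r :: "'n \<Rightarrow> 'a"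
  assumes "field_Z_basis I r" "\<epsilon> \<in> unit_group \<sigma> I"
  shows "inverse \<epsilon> \<in> unit_group \<sigma> I"
proof (rule unit_groupI[OF assms(1)])
  have "(*) (inverse \<epsilon>) ` I = (*) (inverse \<epsilon>) ` ((*) \<epsilon> ` I)"
    using assms(2) by (simp add: unit_group_image)
  also have "\<dots> = I"
    using unit_group_nonzero[OF assms(2)] by (simp add: image_image flip: mult.assoc)
  finally show "(*) (inverse \<epsilon>) ` I = I" .
qed (use assms in \<open>simp_all add: unit_group_pos unit_group_nonzero\<close>)

section \<open>Action of the units on the lattice, and the double coset of a torus point\<close>

lemma row_lattice_diag_embed:
  assumes "row_lattice B = (\<lambda>x. c *\<^sub>R embed \<sigma> x) ` I" "\<epsilon> \<in> unit_group \<sigma> I"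
  shows "row_lattice (B ** diag_embed \<sigma> \<epsilon>) = row_lattice B"
proof -
  have "row_lattice (B ** diag_embed \<sigma> \<epsilon>) = (\<lambda>x. c *\<^sub>R embed \<sigma> x) ` ((*) \<epsilon> ` I)"
    by (simp add: row_lattice_mult assms(1) image_image scaleR_vector_matrix_assoc embed_diag_embed)
  then show ?thesis by (simp add: assms unit_group_image)
qed

lemma lattice_pointE:
  assumes "B \<in> lattice_point \<sigma> I"
  obtains c where "det B = 1" "c > 0" "row_lattice B = (\<lambda>x. c *\<^sub>R embed \<sigma> x) ` I"
  using assms by (auto simp: lattice_point_def SLR_def)

text \<open>Two members span multiples of the same lattice, with ratio \<open>t\<close>, so integral
  matrices relate \<open>B\<close> and \<open>t *\<^sub>R B0\<close> in both directions. Their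
  determinants have product 1, and \<open>det D = t ^ CARD('n)\<close> is positive, so both are 1;
  this forces \<open>t = 1\<close>.\<close>

lemma lattice_point_eq:
  assumes B0: "B0 \<in> lattice_point \<sigma> I"
  shows "lattice_point \<sigma> I = {C ** B0 | C. C \<in> SLZ}"
proof (intro equalityI subsetI)
  fix B assume B: "B \<in> lattice_point \<sigma> I"
  obtain c where c: "det B = 1" "c > 0" "row_lattice B = (\<lambda>x. c *\<^sub>R embed \<sigma> x) ` I"
    using B by (rule lattice_pointE)
  obtain c0 where c0: "det B0 = 1" "c0 > 0" "row_lattice B0 = (\<lambda>x. c0 *\<^sub>R embed \<sigma> x) ` I"
    using B0 by (rule lattice_pointE)
  define t where "t = c / c0"
  have t: "t > 0" using c(2) c0(2) by (simp add: t_def)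
  have eq: "row_lattice B = row_lattice (t *\<^sub>R B0)"
    using c0(2) by (simp add: row_lattice_scaleR c(3) c0(3) image_image t_def)
  obtain C where C: "B = of_int_mat C ** (t *\<^sub>R B0)"
    using eq by (metis order_refl row_lattice_subsetD)
  obtain D where D: "t *\<^sub>R B0 = of_int_mat D ** B"
    using eq by (metis order_refl row_lattice_subsetD)
  have "det B = of_int (det C) * (t ^ CARD('n) * det B0)"
    by (subst C) (simp only: det_mul det_of_int_mat det_scaleR)
  then have 1: "of_int (det C) * t ^ CARD('n) = 1" using c c0 by simp
  have "t ^ CARD('n) * det B0 = of_int (det D) * det B"
    using arg_cong[OF D, of det] by (simp only: det_mul det_of_int_mat det_scaleR)
  then have 2: "t ^ CARD('n) = of_int (det D)" using c c0 by simp
  have "of_int (det D) > (0::real)" using t by (simp flip: 2)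
  then have D0: "det D > 0" by simp
  have "real_of_int (det C * det D) = 1" using 1 2 by simp
  then have "det C * det D = 1" by linarith
  with D0 have det1: "det C = 1" "det D = 1" by (auto simp: zmult_eq_1_iff)
  with 2 have "t ^ CARD('n) = 1 ^ CARD('n)" by simp
  then have "t = 1" using t power_eq_imp_eq_base[of t "CARD('n)" 1] by simp
  with C have "B = of_int_mat C ** B0" by simp
  with det1 show "B \<in> {C ** B0 | C. C \<in> SLZ}" by (auto simp: mem_SLZ_iff)
next
  fix B assume "B \<in> {C ** B0 | C. C \<in> SLZ}"
  then obtain C where "C \<in> SLZ" "B = C ** B0" by auto
  with B0 show "B \<in> lattice_point \<sigma> I"
    by (simp add: lattice_point_def SLR_def row_lattice_SLZ_mult det_mul det_SLZ)
qed

text \<open>Multiplication by \<open>\<epsilon>\<close> maps the lattice onto itself, so the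
  determinant is an integer with integral inverse, and total positivity excludes -1. Hence units
  preserve \<open>pos_diag\<close>.\<close>

lemma det_diag_embed_unit:
  fixes r :: "'n \<Rightarrow> 'a"
  assumes r: "field_Z_basis I r" and \<epsilon>: "\<epsilon> \<in> unit_group \<sigma> I"
  shows "det (diag_embed \<sigma> \<epsilon>) = 1"
proof -
  obtain B where "B \<in> lattice_point \<sigma> I" using lattice_point_nonempty[OF r] by blast
  then obtain c where c: "det B = 1" "row_lattice B = (\<lambda>x. c *\<^sub>R embed \<sigma> x) ` I"
    by (rule lattice_pointE)
  note eq = row_lattice_diag_embed[OF c(2) \<epsilon>]
  obtain C where C: "B ** diag_embed \<sigma> \<epsilon> = of_int_mat C ** B"
    using eq by (metis order_refl row_lattice_subsetD)
  obtain D where D: "B = of_int_mat D ** (B ** diag_embed \<sigma> \<epsilon>)"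
    using eq by (metis order_refl row_lattice_subsetD)
  define d where "d = det (diag_embed \<sigma> \<epsilon>)"
  have "d > 0"
    unfolding d_def det_diag_embed by (intro prod_pos) (simp add: unit_group_pos[OF \<epsilon>])
  have 1: "d = of_int (det C)"
    using arg_cong[OF C, of det] c(1) by (simp add: det_mul det_of_int_mat d_def)
  have 2: "1 = of_int (det D) * d"
    using arg_cong[OF D, of det] c(1) by (simp add: det_mul det_of_int_mat d_def)
  have "real_of_int (det D * det C) = 1" using 1 2 by simp
  then have "det D * det C = 1" by linarith
  moreover have "det C > 0" using \<open>d > 0\<close> 1 by simp
  ultimately have "det C = 1" by (auto simp: zmult_eq_1_iff)
  with 1 show ?thesis by (simp add: d_def)
qed

lemma diag_embed_mult_pos_diag:
  fixes r :: "'n \<Rightarrow> 'a"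
  assumes "field_Z_basis I r" "\<epsilon> \<in> unit_group \<sigma> I" "A \<in> pos_diag"
  shows "diag_embed \<sigma> \<epsilon> ** A \<in> pos_diag"
proof -
  have "(diag_embed \<sigma> \<epsilon> ** A) $ i $ j = (if i = j then \<sigma> i \<epsilon> * A $ i $ i else 0)" for i j
    using pos_diag_offdiag[OF assms(3), of i j]
    by (simp add: matrix_matrix_mult_def if_distrib[of "\<lambda>x. x * _"] cong: if_cong)
  moreover have "det (diag_embed \<sigma> \<epsilon> ** A) = 1"
    using det_diag_embed_unit[OF assms(1,2)] det_pos_diag[OF assms(3)] by (simp add: det_mul)
  ultimately show ?thesis
    using unit_group_pos[OF assms(2)] pos_diag_pos[OF assms(3)] by (simp add: pos_diag_def SLR_def)
qed

lemma torus_class_self: "A \<in> torus_class \<sigma> I A"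
  unfolding torus_class_def using unit_group_1 diag_embed_1
  by (metis (mono_tags, lifting) mem_Collect_eq matrix_mul_lid)

lemma torus_class_eqI:
  fixes r :: "'n \<Rightarrow> 'a"
  assumes r: "field_Z_basis I r" and A: "A \<in> torus_class \<sigma> I A1"
  shows "torus_class \<sigma> I A1 = torus_class \<sigma> I A"
proof -
  obtain \<epsilon> where \<epsilon>: "\<epsilon> \<in> unit_group \<sigma> I" "A = diag_embed \<sigma> \<epsilon> ** A1"
    using A by (auto simp: torus_class_def)
  have A1: "A1 = diag_embed \<sigma> (inverse \<epsilon>) ** A"
    using unit_group_nonzero[OF \<epsilon>(1)]
    by (simp add: \<epsilon>(2) matrix_mul_assoc diag_embed_mult diag_embed_1)
  show ?thesis
  proof (intro equalityI subsetI)
    fix X assume "X \<in> torus_class \<sigma> I A1"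
    then obtain \<delta> where \<delta>: "\<delta> \<in> unit_group \<sigma> I" "X = diag_embed \<sigma> \<delta> ** A1"
      by (auto simp: torus_class_def)
    then have "X = diag_embed \<sigma> (\<delta> * inverse \<epsilon>) ** A"
      by (simp add: A1 matrix_mul_assoc diag_embed_mult)
    then show "X \<in> torus_class \<sigma> I A"
      using unit_group_mult[OF r \<delta>(1) unit_group_inverse[OF r \<epsilon>(1)]]
      by (auto simp: torus_class_def)
  next
    fix X assume "X \<in> torus_class \<sigma> I A"
    then obtain \<delta> where \<delta>: "\<delta> \<in> unit_group \<sigma> I" "X = diag_embed \<sigma> \<delta> ** A"
      by (auto simp: torus_class_def)
    then have "X = diag_embed \<sigma> (\<delta> * \<epsilon>) ** A1"
      by (simp add: \<epsilon>(2) matrix_mul_assoc diag_embed_mult)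
    then show "X \<in> torus_class \<sigma> I A1"
      using unit_group_mult[OF r \<delta>(1) \<epsilon>(1)] by (auto simp: torus_class_def)
  qed
qed

text \<open>The matrix of a unit stands to the left of \<open>A\<close> and is absorbed into the
  lattice point, which it preserves. So the whole class contributes only the double coset of one
  product, and \<open>flat_map\<close> takes values in the moduli space.\<close>

lemma flat_map_torus_class:
  fixes r :: "'n \<Rightarrow> 'a"
  assumes r: "field_Z_basis I r" and B0: "B0 \<in> lattice_point \<sigma> I"
  shows "flat_map \<sigma> I (torus_class \<sigma> I A) = double_coset (B0 ** A)"
proof (intro equalityI subsetI)
  fix X assume "X \<in> flat_map \<sigma> I (torus_class \<sigma> I A)"
  then obtain B \<epsilon> K where X: "X = B ** (diag_embed \<sigma> \<epsilon> ** A) ** K"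
    and B: "B \<in> lattice_point \<sigma> I" and \<epsilon>: "\<epsilon> \<in> unit_group \<sigma> I" and K: "K \<in> SOR"
    by (auto simp: flat_map_def torus_class_def)
  obtain c where c: "det B = 1" "c > 0" "row_lattice B = (\<lambda>x. c *\<^sub>R embed \<sigma> x) ` I"
    using B by (rule lattice_pointE)
  have "det (B ** diag_embed \<sigma> \<epsilon>) = 1"
    by (simp add: det_mul c(1) det_diag_embed_unit[OF r \<epsilon>])
  with c have "B ** diag_embed \<sigma> \<epsilon> \<in> lattice_point \<sigma> I"
    by (auto simp: lattice_point_def SLR_def row_lattice_diag_embed[OF c(3) \<epsilon>])
  then obtain C where "C \<in> SLZ" "B ** diag_embed \<sigma> \<epsilon> = C ** B0"
    using lattice_point_eq[OF B0] by auto
  then have "X = C ** (B0 ** A) ** K" by (simp add: X matrix_mul_assoc)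
  with \<open>C \<in> SLZ\<close> K show "X \<in> double_coset (B0 ** A)" by (auto simp: double_coset_def)
next
  fix X assume "X \<in> double_coset (B0 ** A)"
  then obtain C K where "C \<in> SLZ" "K \<in> SOR" "X = (C ** B0) ** A ** K"
    by (auto simp: double_coset_def matrix_mul_assoc)
  moreover from this have "C ** B0 \<in> lattice_point \<sigma> I"
    using lattice_point_eq[OF B0] by auto
  ultimately show "X \<in> flat_map \<sigma> I (torus_class \<sigma> I A)"
    unfolding flat_map_def using torus_class_self by blast
qed

lemma mat_1_SLZ: "mat 1 \<in> SLZ"
  by (simp add: SLZ_def SLR_def) (simp add: mat_def)

lemma mat_1_SOR: "mat 1 \<in> SOR"
  by (simp add: SOR_def rotation_matrix_def orthogonal_matrix_id)

text \<open>A representative \<open>C ** (B0 ** A) ** K\<close> has as row lattice the image of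
  \<open>I\<close> under \<open>T K\<close>: the factor \<open>C\<close> only changes the basis, and
  \<open>K\<close> is an isometry. The inner product pulls back to \<open>c\<^sup>2\<close> times
  \<open>qf A\<close>, so the orthogonal bases of any representative correspond to those of
  \<open>I\<close> for \<open>A\<close>.\<close>

lemma flat_map_in_Rec_iff:
  fixes r :: "'n \<Rightarrow> 'a"
  assumes r: "field_Z_basis I r" and A: "A \<in> pos_diag"
  shows "flat_map \<sigma> I (torus_class \<sigma> I A) \<in> Rec \<longleftrightarrow> (\<exists>r. orth_basis I A r)"
proof -
  obtain B0 where B0: "B0 \<in> lattice_point \<sigma> I" using lattice_point_nonempty[OF r] by blast
  then obtain c where c: "det B0 = 1" "c > 0" "row_lattice B0 = (\<lambda>x. c *\<^sub>R embed \<sigma> x) ` I"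
    by (rule lattice_pointE)
  define T where "T K x = (c *\<^sub>R embed \<sigma> x) v* (A ** K)" for K :: "real ^ 'n ^ 'n" and x
  have rows: "row_lattice (C ** (B0 ** A) ** K) = T K ` I" if "C \<in> SLZ" for C K
  proof -
    have "row_lattice (C ** (B0 ** A) ** K) = row_lattice (B0 ** (A ** K))"
      using row_lattice_SLZ_mult[OF that] by (simp flip: matrix_mul_assoc)
    then show ?thesis by (simp add: row_lattice_mult c(3) image_image T_def)
  qed
  have basis: "vec_Z_basis (T K ` I) (\<lambda>i. T K (s i)) \<longleftrightarrow> field_Z_basis I s" if "K \<in> SOR"
    for K and s :: "'n \<Rightarrow> 'a"
  proof (rule Z_basis_image_iff)
    have "det (A ** K) = 1"
      using that by (simp add: det_mul det_pos_diag[OF A] SOR_def rotation_matrix_def)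
    then have "invertible (A ** K)" by (simp add: invertible_det_nz)
    note inj = inj_vector_matrix_mult[OF this]
    show "inj (T K)"
    proof (rule injI)
      fix x y assume "T K x = T K y"
      then have "c *\<^sub>R embed \<sigma> x = c *\<^sub>R embed \<sigma> y"
        unfolding T_def by (rule injD[OF inj])
      with c(2) show "x = y" by (simp add: inj_eq[OF inj_embed])
    qed
  next
    fix m :: "int ^ 'n"
    have "T K x = embed \<sigma> x v* (c *\<^sub>R (A ** K))" for x
      by (simp add: T_def scaleR_vector_matrix_assoc vector_scaleR_matrix_ac)
    moreover have "(\<Sum>i\<in>UNIV. x i) v* M = (\<Sum>i\<in>UNIV. x i v* M)"
      for x :: "'n \<Rightarrow> real ^ 'n" and M :: "real ^ 'n ^ 'n"
      using sum_comp_morphism[of "\<lambda>v. v v* M" x UNIV]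
      by (simp add: vector_matrix_left_distrib comp_def)
    ultimately show "T K (\<Sum>i\<in>UNIV. of_int (m $ i) * s i) = (\<Sum>i\<in>UNIV. of_int (m $ i) *\<^sub>R T K (s i))"
      by (simp add: embed_sum embed_of_int_mult scaleR_vector_matrix_assoc)
  qed
  have inner: "T K x \<bullet> T K y = c\<^sup>2 * qf A x y" if "K \<in> SOR" for K x y
    using that inner_vector_matrix_orthogonal[of K]
    by (simp add: T_def qf_def SOR_def rotation_matrix_def scaleR_vector_matrix_assoc
        power2_eq_square flip: vector_matrix_mul_assoc)
  have fm: "flat_map \<sigma> I (torus_class \<sigma> I A) = double_coset (B0 ** A)"
    by (rule flat_map_torus_class[OF r B0])
  have mod: "double_coset (B0 ** A) \<in> moduli_space"
    by (simp add: moduli_space_def SLR_def det_mul c(1) det_pos_diag[OF A])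
  show ?thesis
  proof
    assume "flat_map \<sigma> I (torus_class \<sigma> I A) \<in> Rec"
    then obtain B b where B: "B \<in> double_coset (B0 ** A)" and b: "vec_Z_basis (row_lattice B) b"
      and orth: "pairwise (\<lambda>i j. orthogonal (b i) (b j)) UNIV"
      by (auto simp: Rec_def fm)
    obtain C K where CK: "C \<in> SLZ" "K \<in> SOR" "B = C ** (B0 ** A) ** K"
      using B by (auto simp: double_coset_def)
    have "row_lattice B = T K ` I" using rows CK by simp
    with b have b: "vec_Z_basis (T K ` I) b" by simp
    then have "b i \<in> T K ` I" for i by (rule Z_basis_elem) auto
    then have "\<exists>x. b i = T K x" for i by blast
    then obtain s where s: "\<And>i. b i = T K (s i)" by metis
    then have bs: "b = (\<lambda>i. T K (s i))" by auto
    have "field_Z_basis I s" using b basis[OF CK(2)] by (simp add: bs)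
    moreover have "qf A (s i) (s j) = 0" if "i \<noteq> j" for i j
      using orth that inner[OF CK(2), of "s i" "s j"] c(2)
      by (simp add: pairwise_def orthogonal_def s)
    ultimately show "\<exists>r. orth_basis I A r" by (auto simp: orth_basis_def)
  next
    assume "\<exists>r. orth_basis I A r"
    then obtain s where s: "orth_basis I A s" by blast
    define B where "B = mat 1 ** (B0 ** A) ** mat 1"
    have "B \<in> double_coset (B0 ** A)"
      unfolding double_coset_def B_def using mat_1_SLZ mat_1_SOR by blast
    moreover have "vec_Z_basis (row_lattice B) (\<lambda>i. T (mat 1) (s i))"
      unfolding B_def rows[OF mat_1_SLZ] basis[OF mat_1_SOR] using s by (simp add: orth_basis_def)
    moreover have "pairwise (\<lambda>i j. orthogonal (T (mat 1) (s i)) (T (mat 1) (s j))) UNIV"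
      using s by (simp add: pairwise_def orthogonal_def inner[OF mat_1_SOR] orth_basis_def)
    ultimately show "flat_map \<sigma> I (torus_class \<sigma> I A) \<in> Rec"
      unfolding fm Rec_def using mod by blast
  qed
qed

section \<open>The correspondence between torus points and classes of bases\<close>

lemma field_Z_basis_unit_mult:
  fixes r :: "'n \<Rightarrow> 'a"
  assumes r: "field_Z_basis I r" and \<epsilon>: "\<epsilon> \<in> unit_group \<sigma> I"
  shows "field_Z_basis I (\<lambda>i. \<epsilon> * r i)"
proof -
  have "field_Z_basis ((*) \<epsilon> ` I) (\<lambda>i. \<epsilon> * r i) \<longleftrightarrow> field_Z_basis I r"
    using unit_group_nonzero[OF \<epsilon>]
    by (intro Z_basis_image_iff) (auto simp: inj_def sum_distrib_left algebra_simps)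
  then show ?thesis by (simp add: r unit_group_image[OF \<epsilon>])
qed

lemma qf_diag_embed: "qf (diag_embed \<sigma> \<epsilon> ** A) x y = qf A (\<epsilon> * x) (\<epsilon> * y)"
  by (simp add: qf_def embed_diag_embed flip: vector_matrix_mul_assoc)

definition orth_bases :: "'a set \<Rightarrow> (real ^ 'n ^ 'n) set \<Rightarrow> ('n \<Rightarrow> 'a) set" where
  "orth_bases I t = {r. \<exists>A\<in>t. orth_basis I A r}"

text \<open>A basis is orthogonal for \<open>diag_embed \<sigma> \<epsilon> ** A\<close> iff its
  multiple by \<open>\<epsilon>\<close> is orthogonal for \<open>A\<close>. So a change of
  representative contributes the unit in \<open>basis_rel\<close>, and
  \<open>orth_basis_unique\<close> contributes the signs and the order.\<close>

lemma orth_bases_torus_class: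
  assumes A: "A \<in> pos_diag" and r: "orth_basis I A r"
  shows "orth_bases I (torus_class \<sigma> I A) = basis_rel \<sigma> I `` {r}"
proof (intro equalityI subsetI)
  have Z: "field_Z_basis I r" using r by (simp add: orth_basis_def)
  fix r' assume "r' \<in> orth_bases I (torus_class \<sigma> I A)"
  then obtain \<epsilon> where \<epsilon>: "\<epsilon> \<in> unit_group \<sigma> I" and r': "orth_basis I (diag_embed \<sigma> \<epsilon> ** A) r'"
    by (auto simp: orth_bases_def torus_class_def)
  have "orth_basis I A (\<lambda>i. \<epsilon> * r' i)"
    using r' field_Z_basis_unit_mult[OF _ \<epsilon>] by (auto simp: orth_basis_def qf_diag_embed)
  then obtain \<eta> :: "'n \<Rightarrow> 'a" and \<pi> where \<eta>: "range \<eta> \<subseteq> {1, -1}" "bij \<pi>"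
      "\<And>i. \<epsilon> * r' i = \<eta> i * r (\<pi> i)"
    using orth_basis_unique[OF A r] by blast
  have "r' i = inverse \<epsilon> * \<eta> i * r (\<pi> i)" for i
    using unit_group_nonzero[OF \<epsilon>] \<eta>(3)[of i] by (simp add: field_simps)
  moreover have "r \<in> rp_bases I" "r' \<in> rp_bases I"
    using orth_basis_imp_rp[OF A r]
      orth_basis_imp_rp[OF diag_embed_mult_pos_diag[OF Z \<epsilon> A] r'] by auto
  ultimately show "r' \<in> basis_rel \<sigma> I `` {r}"
    using unit_group_inverse[OF Z \<epsilon>] \<eta>(1,2) unfolding basis_rel_def by blast
next
  have Z: "field_Z_basis I r" using r by (simp add: orth_basis_def)
  fix r' assume "r' \<in> basis_rel \<sigma> I `` {r}"
  then obtain \<epsilon> and \<eta> :: "'n \<Rightarrow> 'a" and \<pi> where r': "r' \<in> rp_bases I" and \<epsilon>: "\<epsilon> \<in> unit_group \<sigma> I"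
    and \<eta>: "range \<eta> \<subseteq> {1, -1}" and \<pi>: "bij \<pi>" and eq: "\<And>i. r' i = \<epsilon> * \<eta> i * r (\<pi> i)"
    by (auto simp: basis_rel_def)
  \<comment> \<open>The unit by which the basis was multiplied is undone by its inverse in the
    matrix.\<close>
  let ?A = "diag_embed \<sigma> (inverse \<epsilon>) ** A"
  have "qf ?A (r' i) (r' j) = 0" if "i \<noteq> j" for i j
  proof -
    have "\<pi> i \<noteq> \<pi> j" using that \<pi> by (simp add: bij_def inj_eq)
    then have 0: "qf A (r (\<pi> i)) (r (\<pi> j)) = 0" using r by (simp add: orth_basis_def)
    have "\<eta> i = of_int 1 \<or> \<eta> i = of_int (- 1)" "\<eta> j = of_int 1 \<or> \<eta> j = of_int (- 1)"
      using \<eta> by auto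
    then obtain a b :: int where ab: "\<eta> i = of_int a" "\<eta> j = of_int b" by blast
    have "qf ?A (r' i) (r' j) = qf A (of_int a * r (\<pi> i)) (of_int b * r (\<pi> j))"
      using unit_group_nonzero[OF \<epsilon>] by (simp add: qf_diag_embed eq ab flip: mult.assoc)
    also have "\<dots> = 0"
      using 0 by (simp add: qf_def embed_of_int_mult scaleR_vector_matrix_assoc)
    finally show ?thesis .
  qed
  then have "orth_basis I ?A r'" using r' by (simp add: orth_basis_def rp_bases_def)
  moreover have "?A \<in> torus_class \<sigma> I A"
    using unit_group_inverse[OF Z \<epsilon>] by (auto simp: torus_class_def)
  ultimately show "r' \<in> orth_bases I (torus_class \<sigma> I A)" by (auto simp: orth_bases_def)
qed

text \<open>If two classes have the same image, a common basis is orthogonal for a representative of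
  each; these representatives coincide by \<open>orth_basis_determines_pos_diag\<close>, so the
  classes do. Surjectivity rests on \<open>rp_imp_orth_basis\<close>.\<close>

lemma bij_betw_orth_bases:
  fixes r0 :: "'n \<Rightarrow> 'a"
  assumes r0: "field_Z_basis I r0"
  shows "bij_betw (orth_bases I) (flat_map \<sigma> I -` Rec \<inter> torus \<sigma> I)
           ((rp_bases I :: ('n \<Rightarrow> 'a) set) // basis_rel \<sigma> I)"
proof -
  define S where "S = flat_map \<sigma> I -` Rec \<inter> torus \<sigma> I"
  have S: "\<exists>A r. A \<in> pos_diag \<and> t = torus_class \<sigma> I A \<and> orth_basis I A r" if "t \<in> S" for t
    using that flat_map_in_Rec_iff[OF r0] by (auto simp: S_def torus_def)
  have "inj_on (orth_bases I) S"
  proof (rule inj_onI)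
    fix t t' assume t: "t \<in> S" "t' \<in> S" and eq: "orth_bases I t = orth_bases I t'"
    obtain A r where A: "A \<in> pos_diag" "t = torus_class \<sigma> I A" "orth_basis I A r"
      using S[OF t(1)] by blast
    obtain A' where A': "A' \<in> pos_diag" "t' = torus_class \<sigma> I A'"
      using S[OF t(2)] by blast
    have "r \<in> orth_bases I t"
      using A torus_class_self by (auto simp: orth_bases_def)
    then obtain X where X: "X \<in> torus_class \<sigma> I A'" "orth_basis I X r"
      using eq A'(2) by (auto simp: orth_bases_def)
    \<comment> \<open>Units keep representatives in \<open>pos_diag\<close>, so the uniqueness of
      the diagonal matrix applies to \<open>X\<close>.\<close>
    have "X \<in> pos_diag"
      using X(1) diag_embed_mult_pos_diag[OF r0 _ A'(1)] by (auto simp: torus_class_def)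
    then have "A = X" using A X(2) orth_basis_determines_pos_diag by blast
    then show "t = t'" using torus_class_eqI[OF r0 X(1)] A(2) A'(2) by simp
  qed
  moreover have "orth_bases I ` S = rp_bases I // basis_rel \<sigma> I"
  proof (intro equalityI subsetI)
    fix Y assume "Y \<in> orth_bases I ` S"
    then obtain A r where "A \<in> pos_diag" "Y = orth_bases I (torus_class \<sigma> I A)" "orth_basis I A r"
      using S by blast
    then show "Y \<in> rp_bases I // basis_rel \<sigma> I"
      using orth_bases_torus_class orth_basis_imp_rp by (auto simp: quotient_def)
  next
    fix Y assume "Y \<in> (rp_bases I :: ('n \<Rightarrow> 'a) set) // basis_rel \<sigma> I"
    then obtain r where r: "r \<in> rp_bases I" "Y = basis_rel \<sigma> I `` {r}"
      by (auto simp: quotient_def)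
    obtain A where A: "A \<in> pos_diag" "orth_basis I A r" by (rule rp_imp_orth_basis[OF r(1)])
    have "torus_class \<sigma> I A \<in> S"
      using A flat_map_in_Rec_iff[OF r0 A(1)] by (auto simp: S_def torus_def)
    then show "Y \<in> orth_bases I ` S" using orth_bases_torus_class[OF A] r(2) by blast
  qed
  ultimately show ?thesis by (simp add: bij_betw_def S_def)
qed

end

theorem theorem1p2:
  fixes \<sigma> :: "'n::finite \<Rightarrow> 'a::field_char_0 \<Rightarrow> real" and I :: "'a set"
  assumes degree: "field_degree TYPE('a) = CARD('n)"
    and real: "totally_real TYPE('a)"
    and embeddings: "bij_betw \<sigma> UNIV {\<phi> :: 'a \<Rightarrow> real. field_embedding \<phi>}"
    and lattice: "lattice_in_field TYPE('n) I"
  shows "\<exists>\<Phi>. bij_betw \<Phi> (flat_map \<sigma> I -` Rec \<inter> torus \<sigma> I)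
                       ((rp_bases I :: ('n \<Rightarrow> 'a) set) // basis_rel \<sigma> I) \<and>
             (\<forall>A \<in> pos_diag. \<forall>r. field_Z_basis I r \<and>
                pairwise (\<lambda>i j. orthogonal (embed \<sigma> (r i) v* A) (embed \<sigma> (r j) v* A)) UNIV \<longrightarrow>
                \<Phi> (torus_class \<sigma> I A) = basis_rel \<sigma> I `` {r})"
proof -
  interpret real_embeddings \<sigma>
    by unfold_locales (use degree embeddings in \<open>auto simp: bij_betw_def\<close>)
  obtain r0 :: "'n \<Rightarrow> 'a" where r0: "field_Z_basis I r0"
    using field_Z_basis_exists[OF lattice] by blast
  \<comment> \<open>With \<open>orth_bases I\<close> as \<open>\<Phi>\<close>, the naturality clause
    is \<open>orth_bases_torus_class\<close>, read through \<open>orth_basis_iff\<close>.\<close>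
  show ?thesis
    using bij_betw_orth_bases[OF r0] orth_bases_torus_class
    by (intro exI[of _ "orth_bases I"]) (auto simp: orth_basis_iff)
qed

end
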